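(* Let $\{\gamma_n\}_{n=0}^\infty$ be a classical multiplier sequence of real numbers with $\gamma_n>0$ for every $n\in\mathbb{N}_0$, and let $T$ be the Hermite diagonal differential operator defined by $T[H_n(x)]:=\gamma_nH_n(x)$ for every $n\in\mathbb{N}_0$. Then $T$ is hyperbolicity preserving if and only if $$T[x^n]\in\mathscr{L}\text{-}\mathscr{P}\qquad\text{for every } n\in\mathbb{N}_0.$$
   Context: $\mathbb{N}_0=\{0,1,2,\ldots\}$. The Hermite polynomials are $H_n(x)=\sum_{k=0}^{\lfloor n/2\rfloor}\frac{(-1)^k n!\,2^{n-2k}}{k!(n-2k)!}x^{n-2k}$; $T$ is extended linearly to $\mathbb{R}[x]$. A linear operator $T:\mathbb{R}[x]\to\mathbb{R}[x]$ is hyperbolicity preserving if $T[p(x)]$ has only real zeros whenever $p(x)\in\mathbb{R}[x]$ has only real zeros (the zero polynomial is regarded as having only real zeros). A real sequence $\{\gamma_n\}_{n=0}^\infty$ is a classical multiplier sequence if the linear operator $x^n\mapsto\gamma_nx^n$ ($n\in\mathbb{N}_0$) is hyperbolicity preserving. The Laguerre–Pólya class $\mathscr{L}\text{-}\mathscr{P}$ is the set of entire functions that are uniform limits (on compact subsets of $\mathbb{C}$) of real polynomials with only real zeros; a real polynomial belongs to $\mathscr{L}\text{-}\mathscr{P}$ exactly when it has only real zeros. *)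

theory Defs
  imports
    "HOL-Complex_Analysis.Complex_Analysis"
    "HOL-Computational_Algebra.Computational_Algebra"
begin

definition cpoly :: "real poly \<Rightarrow> complex \<Rightarrow> complex" where
  "cpoly p z = poly (map_poly complex_of_real p) z"

text \<open>Zeros are taken in the complex plane; the zero polynomial counts as having only real zeros.\<close>

definition only_real_zeros :: "real poly \<Rightarrow> bool" where
  "only_real_zeros p \<longleftrightarrow> p = 0 \<or> (\<forall>z. cpoly p z = 0 \<longrightarrow> z \<in> \<real>)"

definition laguerre_polya :: "(complex \<Rightarrow> complex) set" where
  "laguerre_polya =
     {f. f holomorphic_on UNIV \<and>
         (\<exists>p :: nat \<Rightarrow> real poly. (\<forall>n. only_real_zeros (p n)) \<and>
            (\<forall>K. compact K \<longrightarrow> uniform_limit K (\<lambda>n. cpoly (p n)) f sequentially))}"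

definition poly_linear :: "(real poly \<Rightarrow> real poly) \<Rightarrow> bool" where
  "poly_linear T \<longleftrightarrow> Vector_Spaces.linear smult smult T"

text \<open>\<^const>\<open>Vector_Spaces.linear\<close> also asserts that \<^const>\<open>smult\<close> is a vector space structure,
  which holds for real polynomials, so \<^const>\<open>poly_linear\<close> is ordinary linearity.\<close>

lemma poly_linear_iff:
  "poly_linear T \<longleftrightarrow> (\<forall>p q. T (p + q) = T p + T q) \<and> (\<forall>c p. T (smult c p) = smult c (T p))"
proof -
  have "vector_space (smult :: real \<Rightarrow> real poly \<Rightarrow> real poly)"
    by unfold_locales (auto simp: smult_add_left smult_add_right)
  then show ?thesis
    by (auto simp: poly_linear_def linear_iff_module_hom module_hom_iff vector_space_def module_def)
qed

definition hyperbolicity_preserving :: "(real poly \<Rightarrow> real poly) \<Rightarrow> bool" where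
  "hyperbolicity_preserving T \<longleftrightarrow>
     poly_linear T \<and> (\<forall>p. only_real_zeros p \<longrightarrow> only_real_zeros (T p))"

text \<open>When \<open>B\<close> is a basis of the real polynomials, as both the monomials and the Hermite
  polynomials are, exactly one \<open>T\<close> satisfies the following predicate.\<close>

definition diagonal_operator ::
    "(nat \<Rightarrow> real poly) \<Rightarrow> (nat \<Rightarrow> real) \<Rightarrow> (real poly \<Rightarrow> real poly) \<Rightarrow> bool" where
  "diagonal_operator B \<gamma> T \<longleftrightarrow> poly_linear T \<and> (\<forall>n. T (B n) = smult (\<gamma> n) (B n))"

definition classical_multiplier_sequence :: "(nat \<Rightarrow> real) \<Rightarrow> bool" where
  "classical_multiplier_sequence \<gamma> \<longleftrightarrow>
     (\<exists>T. diagonal_operator (\<lambda>n. monom 1 n) \<gamma> T \<and> hyperbolicity_preserving T)"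

definition hermite :: "nat \<Rightarrow> real poly" where
  "hermite n = (\<Sum>k\<le>n div 2.
     monom ((- 1) ^ k * fact n * 2 ^ (n - 2 * k) / (fact k * fact (n - 2 * k))) (n - 2 * k))"

end

theory Submission
  imports Defs
begin

text \<open>Write \<open>D\<close> for differentiation. For a positive multiplier sequence \<open>\<gamma>\<close> both sides of the equivalence
say the same thing, namely that \<open>\<gamma>\<close> is nondecreasing.

If every \<open>T[x^n]\<close> has only real zeros, then so has the \<open>n\<close>-th derivative of \<open>T[x^(n+2)]\<close>. This is a
quadratic polynomial without linear term, and its coefficients show that \<open>\<gamma> n \<le> \<gamma> (n + 2)\<close>
(\<open>two_step_mono_if_only_real_zeros\<close>). A multiplier sequence is log-concave, so a positive one that
decreases once decreases from there on; hence \<open>\<gamma>\<close> is nondecreasing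
(\<open>real_rooted_jensen_mono_if_two_step_mono\<close>).

Now let \<open>\<gamma>\<close> be nondecreasing, and let \<open>\<beta> j\<close> be its \<open>j\<close>-th forward difference at \<open>0\<close>. The operator
\<open>(x - D/2)^j D^j\<close> multiplies \<open>H_n\<close> by \<open>n (n-1) ... (n-j+1)\<close>, so Newton's forward difference formula
gives \<open>T = \<Sum>j. \<beta> j / j! (x - D/2)^j D^j\<close> (\<open>hermite_diagonal_operator_formula\<close>). The Jensen
polynomials \<open>\<Sum>k. (n choose k) \<beta> k x^k\<close> arise from those of \<open>\<gamma>\<close> by a real Moebius substitution, so
they have only real zeros. Moreover every \<open>\<beta> j\<close> is nonnegative (\<open>iterated_fdiff_at_0_nonneg\<close>): the
discriminant of the cubic Jensen polynomials forces the differences of \<open>\<gamma>\<close> to be nondecreasing again,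
which permits induction. So the Jensen polynomials of \<open>\<beta>\<close> have only negative zeros.

Finally, let \<open>p\<close> have only real zeros, and replace \<open>x - D/2\<close> by a second variable \<open>y\<close>. The polynomial
\<open>\<Sum>j. \<beta> j / j! y^j D^j p(x)\<close> is a limit of polynomials obtained from \<open>p\<close> by products of operators
\<open>a + y D\<close> with \<open>a > 0\<close>, and such an operator creates no zeros with \<open>x\<close> and \<open>y\<close> in the open upper
half-plane. To return from \<open>y\<close> to \<open>x - D/2\<close>, one applies the exponential of \<open>- (2 D_x D_y + D_y^2) / 4\<close>
and then sets \<open>y = x\<close> (\<open>normal_ordering_monom\<close>). This exponential is the limit of the powers
\<open>(1 - (2 D_x D_y + D_y^2) / (4 N))^N\<close>, and each factor keeps the half-plane condition
(\<open>bistable_coupling_step\<close>). So \<open>T p\<close> is a limit of polynomials without zeros in the upper half-plane,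
and Hurwitz's theorem finishes the proof (\<open>hermite_operator_preserves_stability\<close>).\<close>

section \<open>Stable polynomials\<close>

definition stable :: "complex poly \<Rightarrow> bool" where
  "stable p \<longleftrightarrow> (\<forall>z. Im z > 0 \<longrightarrow> poly p z \<noteq> 0)"

abbreviation cplx :: "real poly \<Rightarrow> complex poly" where
  "cplx \<equiv> map_poly complex_of_real"

lemma cplx_add: "cplx (p + q) = cplx p + cplx q"
  by (rule poly_eqI) (simp add: coeff_map_poly)

lemma cplx_smult: "cplx (smult c p) = smult (of_real c) (cplx p)"
  by (rule poly_eqI) (simp add: coeff_map_poly)

lemma cplx_sum: "cplx (sum f A) = (\<Sum>i\<in>A. cplx (f i))"
  by (induction A rule: infinite_finite_induct) (simp_all add: cplx_add)

lemma smult_sum_distrib: "smult c (sum f A) = (\<Sum>i\<in>A. smult c (f i))"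
  by (induction A rule: infinite_finite_induct) (simp_all add: smult_add_right)

lemma complex_poly_linear_factor_induct [case_names const linear_factor]:
  fixes p :: "complex poly"
  assumes "\<And>c. P [:c:]" and "\<And>r q. P q \<Longrightarrow> P ([:-r, 1:] * q)"
  shows "P p"
proof (induction "degree p" arbitrary: p)
  case 0
  then show ?case by (metis assms(1) degree_0_id)
next
  case (Suc n)
  then have "\<not> constant (poly p)" by (simp add: constant_degree)
  then obtain r where "poly p r = 0" using fundamental_theorem_of_algebra by blast
  then obtain q where q: "p = [:-r, 1:] * q" using poly_eq_0_iff_dvd by (metis dvdE)
  then have "q \<noteq> 0" using Suc.hyps(2) by auto
  then have "degree p = Suc (degree q)" unfolding q by (subst degree_mult_eq) auto
  then show ?case using Suc assms(2) q by simp
qed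

lemma stable_linear_factor_iff: "stable ([:-r, 1:] * q) \<longleftrightarrow> Im r \<le> 0 \<and> stable q"
  unfolding stable_def by (force simp: not_le)

lemma Im_inverse_neg_iff: "Im (inverse w) < 0 \<longleftrightarrow> Im w > 0"
proof (cases "w = 0")
  case False
  then have "(Re w)\<^sup>2 + (Im w)\<^sup>2 > 0" by (simp add: complex_neq_0)
  then show ?thesis by (auto simp: divide_less_0_iff zero_less_divide_iff)
qed simp

text \<open>The logarithmic derivative is the sum of \<open>1 / (z - r)\<close> over the zeros \<open>r\<close>, and each \<open>z - r\<close> lies in
the upper half-plane.\<close>

lemma logarithmic_derivative_stable:
  assumes "stable p" and z: "Im z > 0"
  shows "Im (poly (pderiv p) z / poly p z) \<le> 0"
    and "degree p > 0 \<Longrightarrow> Im (poly (pderiv p) z / poly p z) < 0"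
proof -
  have "stable p \<longrightarrow> Im (poly (pderiv p) z / poly p z) \<le> 0 \<and>
          (degree p > 0 \<longrightarrow> Im (poly (pderiv p) z / poly p z) < 0)"
  proof (induction p rule: complex_poly_linear_factor_induct)
    case (const c)
    then show ?case by (simp add: pderiv_pCons)
  next
    case (linear_factor r q)
    show ?case
    proof
      assume "stable ([:-r, 1:] * q)"
      then have r: "Im r \<le> 0" and q: "stable q" by (simp_all only: stable_linear_factor_iff)
      have "poly q z \<noteq> 0" and "z - r \<noteq> 0" using q z r by (auto simp: stable_def)
      then have "poly (pderiv ([:-r, 1:] * q)) z / poly ([:-r, 1:] * q) z
          = inverse (z - r) + poly (pderiv q) z / poly q z"
        unfolding pderiv_mult poly_mult poly_add by (simp add: pderiv_pCons field_simps)
      moreover have "Im (inverse (z - r)) < 0"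
        using r z by (subst Im_inverse_neg_iff) simp
      ultimately show "Im (poly (pderiv ([:-r, 1:] * q)) z / poly ([:-r, 1:] * q) z) \<le> 0 \<and>
          (degree ([:-r, 1:] * q) > 0 \<longrightarrow>
             Im (poly (pderiv ([:-r, 1:] * q)) z / poly ([:-r, 1:] * q) z) < 0)"
        using linear_factor q by force
    qed
  qed
  then show "Im (poly (pderiv p) z / poly p z) \<le> 0"
    and "degree p > 0 \<Longrightarrow> Im (poly (pderiv p) z / poly p z) < 0"
    using assms by auto
qed

text \<open>The Gauss-Lucas theorem for the lower half-plane.\<close>

lemma stable_pderiv:
  assumes "stable p" shows "pderiv p = 0 \<or> stable (pderiv p)"
  using logarithmic_derivative_stable(2)[OF assms] unfolding stable_def pderiv_eq_0_iff
  by fastforce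

lemma stable_higher_pderiv:
  assumes "stable p" shows "(pderiv ^^ j) p = 0 \<or> stable ((pderiv ^^ j) p)"
  by (induction j) (use assms stable_pderiv in auto)

lemma pderiv_cplx: "pderiv (cplx p) = cplx (pderiv p)"
  by (rule poly_eqI) (simp add: coeff_pderiv coeff_map_poly)

lemma cplx_higher_pderiv: "cplx ((pderiv ^^ j) p) = (pderiv ^^ j) (cplx p)"
  by (induction j) (simp_all flip: pderiv_cplx)

text \<open>The zeros of a real polynomial are symmetric about the real axis.\<close>

lemma only_real_zeros_iff_stable: "only_real_zeros p \<longleftrightarrow> p = 0 \<or> stable (cplx p)"
proof -
  have "poly (cplx p) (cnj z) = cnj (poly (cplx p) z)" for z
    by (subst poly_cnj) (simp add: map_poly_map_poly o_def)
  then have *: "poly (cplx p) z \<noteq> 0" if "\<forall>z. Im z > 0 \<longrightarrow> poly (cplx p) z \<noteq> 0" "Im z \<noteq> 0" for z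
    using that(1)[rule_format, of z] that(1)[rule_format, of "cnj z"] that(2)
    by (cases "Im z > 0") auto
  show ?thesis
    unfolding only_real_zeros_def stable_def cpoly_def complex_is_Real_iff
    using * by (metis less_irrefl)
qed

lemma only_real_zeros_pderiv: "only_real_zeros p \<Longrightarrow> only_real_zeros (pderiv p)"
  using stable_pderiv[of "cplx p"]
  by (auto simp: only_real_zeros_iff_stable pderiv_cplx map_poly_eq_0_iff)

lemma only_real_zeros_higher_pderiv: "only_real_zeros p \<Longrightarrow> only_real_zeros ((pderiv ^^ j) p)"
  by (induction j) (auto intro: only_real_zeros_pderiv)

lemma only_real_zeros_smult_iff: "c \<noteq> 0 \<Longrightarrow> only_real_zeros (smult c p) \<longleftrightarrow> only_real_zeros p"
  by (simp add: only_real_zeros_def cpoly_def map_poly_smult)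

lemma only_real_zeros_quadratic:
  assumes "only_real_zeros [:a, 2 * b, c:]"
  shows "a * c \<le> b\<^sup>2"
proof (rule ccontr)
  assume "\<not> a * c \<le> b\<^sup>2"
  then have D: "a * c - b\<^sup>2 > 0" by simp
  then have c: "c \<noteq> 0" by (auto simp: not_less)
  define s where "s = sqrt (a * c - b\<^sup>2)"
  have s: "s > 0" "s\<^sup>2 = a * c - b\<^sup>2" using D by (auto simp: s_def)
  define z where "z = Complex (- b / c) (s / c)"
  have "cpoly [:a, 2 * b, c:] z = a + 2 * b * z + c * z\<^sup>2"
    using c by (simp add: cpoly_def map_poly_pCons algebra_simps power2_eq_square)
  also have "\<dots> = 0"
  proof (rule complex_eqI)
    have "a + 2 * b * (- b / c) + c * ((b / c)\<^sup>2 - (s / c)\<^sup>2) = (a * c - b\<^sup>2 - s\<^sup>2) / c"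
      using c by (simp add: power2_eq_square field_simps)
    then show "Re (a + 2 * b * z + c * z\<^sup>2) = Re 0"
      using s(2) by (simp add: z_def power2_eq_square)
    show "Im (a + 2 * b * z + c * z\<^sup>2) = Im 0"
      using c by (simp add: z_def power2_eq_square field_simps)
  qed
  finally have "z \<in> \<real>" using assms c by (auto simp: only_real_zeros_def)
  then show False using s c by (simp add: complex_is_Real_iff z_def)
qed

text \<open>Up to the factor \<open>27\<close>, the difference of the two sides is the discriminant of the cubic. It is made
visible by splitting off one real zero \<open>x\<close>: the discriminant is that of the quadratic cofactor times
the square of the value of the cofactor at \<open>x\<close>.\<close>

lemma only_real_zeros_cubic:
  assumes rz: "only_real_zeros [:a, 3 * b, 3 * c, d:]" and d: "d \<noteq> 0"
  shows "(b * c - a * d)\<^sup>2 \<le> 4 * (b\<^sup>2 - a * c) * (c\<^sup>2 - b * d)"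
proof -
  let ?p = "[:a, 3 * b, 3 * c, d:]"
  have "\<not> constant (poly (cplx ?p))"
    using d by (simp add: constant_degree map_poly_pCons)
  then obtain z where z: "cpoly ?p z = 0"
    unfolding cpoly_def using fundamental_theorem_of_algebra by blast
  then have "z \<in> \<real>" using rz d unfolding only_real_zeros_def by auto
  then obtain x where x: "z = complex_of_real x" by (auto elim: Reals_cases)
  have "complex_of_real (poly ?p x) = cpoly ?p z"
    by (simp add: cpoly_def x map_poly_pCons)
  then have "poly ?p x = 0" using z by (simp only: of_real_eq_0_iff)
  then have a: "a = - (x * (3 * b + x * (3 * c + x * d)))" by (simp add: algebra_simps)
  define v where "v = (3 * c + x * d) / 2"
  define u where "u = 3 * b + x * (3 * c + x * d)"
  have bc: "c = (2 * v - x * d) / 3" "b = (u - 2 * v * x) / 3" "a = - x * u"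
    by (simp_all add: u_def v_def a field_simps)
  have fac: "?p = [:-x, 1:] * [:u, 2 * v, d:]"
    by (simp add: bc)
  have "only_real_zeros [:u, 2 * v, d:]"
  proof -
    have "cplx ([:-x, 1:] * [:u, 2 * v, d:]) = cplx [:-x, 1:] * cplx [:u, 2 * v, d:]"
      by (simp add: map_poly_pCons)
    then show ?thesis
      using rz d unfolding fac by (auto simp: only_real_zeros_def cpoly_def)
  qed
  then have "u * d \<le> v\<^sup>2" by (rule only_real_zeros_quadratic)
  then have "0 \<le> 4 / 27 * (v\<^sup>2 - u * d) * (u + 2 * v * x + d * x\<^sup>2)\<^sup>2" by simp
  also have "\<dots> = 4 * (b\<^sup>2 - a * c) * (c\<^sup>2 - b * d) - (b * c - a * d)\<^sup>2"
    unfolding bc by (simp add: field_simps power2_eq_square)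
  finally show ?thesis by simp
qed

section \<open>Jensen polynomials and finite differences\<close>

definition jensen :: "nat \<Rightarrow> (nat \<Rightarrow> real) \<Rightarrow> real poly" where
  "jensen n \<gamma> = (\<Sum>k\<le>n. monom (of_nat (n choose k) * \<gamma> k) k)"

text \<open>The homogeneous form of the Jensen polynomial: linear substitutions in the pair \<open>(a, b)\<close> become
Moebius transformations of the zeros.\<close>

definition jensen_form :: "nat \<Rightarrow> (nat \<Rightarrow> real) \<Rightarrow> complex \<Rightarrow> complex \<Rightarrow> complex" where
  "jensen_form n \<gamma> a b = (\<Sum>k\<le>n. of_nat (n choose k) * of_real (\<gamma> k) * a ^ k * b ^ (n - k))"

lemma coeff_jensen: "coeff (jensen n \<gamma>) k = of_nat (n choose k) * \<gamma> k"
  by (cases "k \<le> n") (auto simp: jensen_def coeff_sum binomial_eq_0)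

lemma cpoly_sum: "cpoly (sum f A) z = (\<Sum>k\<in>A. cpoly (f k) z)"
  by (simp add: cpoly_def cplx_sum poly_sum)

lemma cpoly_jensen: "cpoly (jensen n \<gamma>) z = jensen_form n \<gamma> z 1"
  unfolding jensen_def jensen_form_def cpoly_sum
  by (simp add: cpoly_def map_poly_monom poly_monom)

lemma jensen_form_homogeneous:
  assumes "b \<noteq> 0"
  shows "jensen_form n \<gamma> a b = b ^ n * jensen_form n \<gamma> (a / b) 1"
proof -
  have "b ^ n * (a / b) ^ k = a ^ k * b ^ (n - k)" if "k \<le> n" for k
    using assms that by (simp add: power_divide power_diff field_simps)
  then show ?thesis
    unfolding jensen_form_def sum_distrib_left by (intro sum.cong) (auto simp: mult_ac)
qed

lemma jensen_form_Suc:
  "jensen_form (Suc n) \<gamma> a b = a * jensen_form n (\<lambda>k. \<gamma> (Suc k)) a b + b * jensen_form n \<gamma> a b"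
proof -
  let ?t = "\<lambda>k. of_nat (n choose k) * complex_of_real (\<gamma> k) * a ^ k * b ^ (Suc n - k)"
  have "b * jensen_form n \<gamma> a b = (\<Sum>k\<le>n. ?t k)"
    unfolding jensen_form_def sum_distrib_left
    by (intro sum.cong) (auto simp: Suc_diff_le mult_ac)
  also have "\<dots> = (\<Sum>k\<le>Suc n. ?t k)" by simp
  also have "\<dots> = ?t 0 + (\<Sum>k\<le>n. ?t (Suc k))" by (rule sum.atMost_Suc_shift)
  finally have "b * jensen_form n \<gamma> a b = ?t 0 + (\<Sum>k\<le>n. ?t (Suc k))" .
  moreover have "jensen_form (Suc n) \<gamma> a b
      = ?t 0 + (\<Sum>k\<le>n. of_nat (Suc n choose Suc k) * of_real (\<gamma> (Suc k)) * a ^ Suc k * b ^ (Suc n - Suc k))"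
    unfolding jensen_form_def by (subst sum.atMost_Suc_shift) simp
  moreover have "\<dots> = ?t 0 + (\<Sum>k\<le>n. ?t (Suc k)) + a * jensen_form n (\<lambda>k. \<gamma> (Suc k)) a b"
    unfolding jensen_form_def sum_distrib_left
    by (simp add: sum.distrib[symmetric] algebra_simps)
  ultimately show ?thesis by simp
qed

definition fdiff :: "(nat \<Rightarrow> real) \<Rightarrow> nat \<Rightarrow> real" where
  "fdiff \<gamma> = (\<lambda>k. \<gamma> (Suc k) - \<gamma> k)"

definition iterated_fdiff_at_0 :: "(nat \<Rightarrow> real) \<Rightarrow> nat \<Rightarrow> real" where
  "iterated_fdiff_at_0 \<gamma> = (\<lambda>j. (fdiff ^^ j) \<gamma> 0)"

lemma iterated_fdiff_shift: "(fdiff ^^ j) (\<lambda>k. \<gamma> (Suc k)) i = (fdiff ^^ j) \<gamma> (Suc i)"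
  by (induction j arbitrary: i) (simp_all add: fdiff_def)

lemma iterated_fdiff_at_0_shift:
  "iterated_fdiff_at_0 (\<lambda>k. \<gamma> (Suc k)) j = iterated_fdiff_at_0 \<gamma> j + iterated_fdiff_at_0 \<gamma> (Suc j)"
  by (simp add: iterated_fdiff_at_0_def iterated_fdiff_shift fdiff_def)

lemma jensen_form_add: "jensen_form n (\<lambda>k. \<gamma> k + \<delta> k) a b = jensen_form n \<gamma> a b + jensen_form n \<delta> a b"
  by (simp add: jensen_form_def sum.distrib[symmetric] algebra_simps)

text \<open>Symbolically, with the shift \<open>E\<close> and the difference \<open>E - 1\<close> acting on \<open>\<gamma>\<close>, both sides are the value at
\<open>0\<close> of \<open>(a E + b)^n \<gamma> = (a (E - 1) + (a + b))^n \<gamma>\<close>.\<close>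

lemma jensen_form_iterated_fdiff:
  "jensen_form n \<gamma> a b = jensen_form n (iterated_fdiff_at_0 \<gamma>) a (a + b)"
proof (induction n arbitrary: \<gamma>)
  case 0
  then show ?case by (simp add: jensen_form_def iterated_fdiff_at_0_def)
next
  case (Suc n)
  show ?case
    unfolding jensen_form_Suc Suc.IH iterated_fdiff_at_0_shift jensen_form_add
    by (simp add: algebra_simps)
qed

definition real_rooted_jensen :: "(nat \<Rightarrow> real) \<Rightarrow> bool" where
  "real_rooted_jensen \<gamma> \<longleftrightarrow> (\<forall>n. only_real_zeros (jensen n \<gamma>))"

lemma poly_linear_sum:
  assumes "poly_linear T" shows "T (sum f A) = (\<Sum>k\<in>A. T (f k))"
proof -
  have add: "T (p + q) = T p + T q" and "T (smult c p) = smult c (T p)" for p q c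
    using assms by (auto simp: poly_linear_iff)
  from this(2)[of 0 0] have "T 0 = 0" by simp
  then show ?thesis
    by (induction A rule: infinite_finite_induct) (auto simp: add)
qed

lemma poly_linear_smult: "poly_linear T \<Longrightarrow> T (smult c p) = smult c (T p)"
  by (simp add: poly_linear_iff)

text \<open>The Jensen polynomial is the image of \<open>(1 + x)^n\<close> under the multiplier operator.\<close>

lemma real_rooted_jensen_multiplier_sequence:
  assumes "classical_multiplier_sequence \<gamma>"
  shows "real_rooted_jensen \<gamma>"
  unfolding real_rooted_jensen_def
proof
  fix n
  obtain S where lin: "poly_linear S" and S: "\<And>k. S (monom 1 k) = smult (\<gamma> k) (monom 1 k)"
    and rz: "\<And>p. only_real_zeros p \<Longrightarrow> only_real_zeros (S p)"
    using assms
    by (auto simp: classical_multiplier_sequence_def diagonal_operator_def hyperbolicity_preserving_def)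
  have "jensen n (\<lambda>_. 1) = (\<Sum>k\<le>n. smult (of_nat (n choose k)) (monom 1 k))"
    by (simp add: jensen_def smult_monom)
  then have "S (jensen n (\<lambda>_. 1)) = jensen n \<gamma>"
    by (simp only: poly_linear_sum[OF lin] poly_linear_smult[OF lin] S jensen_def)
       (simp add: smult_monom mult_ac)
  moreover have "cpoly (jensen n (\<lambda>_. 1)) z = (z + 1) ^ n" for z
    by (simp add: cpoly_jensen jensen_form_def binomial_ring)
  then have "only_real_zeros (jensen n (\<lambda>_. 1))"
    by (auto simp: only_real_zeros_def add_eq_0_iff2)
  ultimately show "only_real_zeros (jensen n \<gamma>)" using rz by metis
qed

lemma pderiv_jensen: "pderiv (jensen (Suc n) \<gamma>) = smult (of_nat (Suc n)) (jensen n (\<lambda>k. \<gamma> (Suc k)))"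
proof (rule poly_eqI)
  fix k
  have "real (Suc k) * real (Suc n choose Suc k) = real (Suc n) * real (n choose k)"
    by (metis Suc_times_binomial_eq mult.commute of_nat_mult)
  then show "coeff (pderiv (jensen (Suc n) \<gamma>)) k
      = coeff (smult (of_nat (Suc n)) (jensen n (\<lambda>k. \<gamma> (Suc k)))) k"
    unfolding coeff_pderiv coeff_smult coeff_jensen by (metis mult.assoc)
qed

lemma real_rooted_jensen_shift:
  assumes "real_rooted_jensen \<gamma>" shows "real_rooted_jensen (\<lambda>k. \<gamma> (m + k))"
proof (induction m)
  case (Suc m)
  have "only_real_zeros (jensen n (\<lambda>k. \<gamma> (m + Suc k)))" for n
    using Suc only_real_zeros_pderiv[of "jensen (Suc n) (\<lambda>k. \<gamma> (m + k))"]
      only_real_zeros_smult_iff[of "of_nat (Suc n)"]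
    unfolding real_rooted_jensen_def pderiv_jensen by (metis of_nat_neq_0)
  then show ?case by (simp add: real_rooted_jensen_def)
qed (use assms in simp)

text \<open>The hypothesis says that \<open>jensen n \<delta>\<close> at \<open>z\<close> is \<open>(1 + c z)^n\<close> times \<open>jensen n \<gamma>\<close> at \<open>z / (1 + c z)\<close>,
and this real Moebius transformation and its inverse map real points to real points.\<close>

lemma only_real_zeros_jensen_Moebius:
  fixes c :: real
  assumes rz: "only_real_zeros (jensen n \<gamma>)"
    and eq: "\<And>z :: complex. jensen_form n \<delta> z 1 = jensen_form n \<gamma> z (1 + complex_of_real c * z)"
  shows "only_real_zeros (jensen n \<delta>)"
proof (cases "jensen n \<gamma> = 0")
  case True
  have "real (n choose k) * \<gamma> k = 0" for k
    using coeff_jensen[of n \<gamma> k] True by simp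
  then have "complex_of_real (real (n choose k) * \<gamma> k) = 0" for k by simp
  then have "of_nat (n choose k) * complex_of_real (\<gamma> k) = 0" for k by simp
  then have "jensen_form n \<gamma> a b = 0" for a b
    unfolding jensen_form_def by (intro sum.neutral ballI) (metis mult_zero_left)
  then have "poly (cplx (jensen n \<delta>)) z = 0" for z
    using eq[of z] by (simp add: cpoly_jensen[unfolded cpoly_def])
  then have "cplx (jensen n \<delta>) = 0" using poly_all_0_iff_0 by blast
  then show ?thesis by (simp add: only_real_zeros_def map_poly_eq_0_iff)
next
  case False
  have "z \<in> \<real>" if "cpoly (jensen n \<delta>) z = 0" for z
  proof (cases "1 + c * z = 0")
    case True
    then have cz: "complex_of_real c * z = - 1" by (simp add: add_eq_0_iff)
    then have "complex_of_real c \<noteq> 0" by auto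
    then have "z = - 1 / complex_of_real c"
      using cz by (metis mult.commute nonzero_eq_divide_eq)
    then show ?thesis by simp
  next
    case nz: False
    define w where "w = z / (1 + c * z)"
    have "jensen_form n \<gamma> w 1 = 0"
      using that nz unfolding cpoly_jensen eq w_def
      by (subst (asm) jensen_form_homogeneous) auto
    then have w: "w \<in> \<real>"
      using rz False by (auto simp: only_real_zeros_def cpoly_jensen)
    have "z * (1 - c * w) = w" using nz by (simp add: w_def field_simps)
    moreover from this have "1 - c * w \<noteq> 0" by auto
    ultimately have "z = w / (1 - c * w)" by (simp add: field_simps)
    then show ?thesis using w by simp
  qed
  then show ?thesis by (simp add: only_real_zeros_def)
qed

lemma real_rooted_jensen_iterated_fdiff:
  assumes "real_rooted_jensen \<gamma>" shows "real_rooted_jensen (iterated_fdiff_at_0 \<gamma>)"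
  unfolding real_rooted_jensen_def
proof
  fix n
  show "only_real_zeros (jensen n (iterated_fdiff_at_0 \<gamma>))"
  proof (rule only_real_zeros_jensen_Moebius)
    show "only_real_zeros (jensen n \<gamma>)" using assms by (simp add: real_rooted_jensen_def)
    show "jensen_form n (iterated_fdiff_at_0 \<gamma>) z 1 = jensen_form n \<gamma> z (1 + complex_of_real (- 1) * z)" for z
      using jensen_form_iterated_fdiff[of n \<gamma> z "1 - z"] by simp
  qed
qed

text \<open>Passing from \<open>\<gamma>\<close> to its differences at \<open>0\<close> turns the operator \<open>fdiff\<close> into a shift, and the Jensen
polynomials of a shifted sequence are derivatives of the original ones, up to constants.\<close>

lemma real_rooted_jensen_fdiff:
  assumes "real_rooted_jensen \<gamma>" shows "real_rooted_jensen (fdiff \<gamma>)"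
  unfolding real_rooted_jensen_def
proof
  fix n
  have "iterated_fdiff_at_0 (fdiff \<gamma>) = (\<lambda>k. iterated_fdiff_at_0 \<gamma> (Suc k))"
    by (simp add: iterated_fdiff_at_0_def funpow_swap1)
  then have eq: "jensen_form n (fdiff \<gamma>) z 1
      = jensen_form n (\<lambda>k. iterated_fdiff_at_0 \<gamma> (1 + k)) z (1 + complex_of_real 1 * z)" for z
    by (subst jensen_form_iterated_fdiff) (simp add: add.commute)
  have "only_real_zeros (jensen n (\<lambda>k. iterated_fdiff_at_0 \<gamma> (1 + k)))"
    using real_rooted_jensen_shift[OF real_rooted_jensen_iterated_fdiff[OF assms]]
    unfolding real_rooted_jensen_def by blast
  then show "only_real_zeros (jensen n (fdiff \<gamma>))"
    using only_real_zeros_jensen_Moebius[OF _ eq] by blast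
qed

lemma real_rooted_jensen_Turan:
  assumes "real_rooted_jensen \<gamma>"
  shows "\<gamma> k * \<gamma> (Suc (Suc k)) \<le> (\<gamma> (Suc k))\<^sup>2"
proof -
  have "jensen 2 (\<lambda>i. \<gamma> (k + i)) = [:\<gamma> k, 2 * \<gamma> (Suc k), \<gamma> (Suc (Suc k)):]"
    by (simp add: jensen_def numeral_2_eq_2 monom_0 monom_Suc)
  then show ?thesis
    using only_real_zeros_quadratic real_rooted_jensen_shift[OF assms, of k]
    by (metis real_rooted_jensen_def)
qed

lemma real_rooted_jensen_cubic:
  assumes "real_rooted_jensen \<gamma>" and "\<gamma> (k + 3) \<noteq> 0"
  shows "(\<gamma> (k + 1) * \<gamma> (k + 2) - \<gamma> k * \<gamma> (k + 3))\<^sup>2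
    \<le> 4 * ((\<gamma> (k + 1))\<^sup>2 - \<gamma> k * \<gamma> (k + 2)) * ((\<gamma> (k + 2))\<^sup>2 - \<gamma> (k + 1) * \<gamma> (k + 3))"
proof (rule only_real_zeros_cubic)
  have "jensen 3 (\<lambda>i. \<gamma> (k + i)) = [:\<gamma> k, 3 * \<gamma> (k + 1), 3 * \<gamma> (k + 2), \<gamma> (k + 3):]"
    by (simp add: jensen_def numeral_3_eq_3 numeral_2_eq_2 monom_0 monom_Suc)
  then show "only_real_zeros [:\<gamma> k, 3 * \<gamma> (k + 1), 3 * \<gamma> (k + 2), \<gamma> (k + 3):]"
    using real_rooted_jensen_shift[OF assms(1), of k] by (metis real_rooted_jensen_def)
qed (fact assms(2))

section \<open>Differences of a nondecreasing multiplier sequence\<close>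

text \<open>Let \<open>d\<close> be the difference sequence of \<open>\<gamma>\<close>, and suppose that \<open>d 1 < d 0\<close>. Then \<open>d\<close> is log-concave, so
its ratios \<open>r k = d (k + 1) / d k\<close> decrease to a limit \<open>\<rho> < 1\<close> and \<open>d\<close> tends to \<open>0\<close>; the cubic
discriminant shows that \<open>d\<close> never vanishes. For \<open>d k\<close> small compared with \<open>\<gamma> k\<close>, the discriminant
of the cubic Jensen polynomial that starts at \<open>k\<close> becomes, after division by \<open>(\<gamma> k * d k)^2\<close>, an
inequality whose limit reads \<open>(1 - \<rho>)^4 \<le> 0\<close>.\<close>

lemma fdiff_nondecreasing_at_0:
  assumes pos: "\<And>k. \<gamma> k > 0" and mono: "\<And>k. \<gamma> k \<le> \<gamma> (Suc k)" and rr: "real_rooted_jensen \<gamma>"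
  shows "fdiff \<gamma> 0 \<le> fdiff \<gamma> 1"
proof (rule ccontr)
  define d where "d = fdiff \<gamma>"
  assume "\<not> fdiff \<gamma> 0 \<le> fdiff \<gamma> 1"
  then have descent: "d 1 < d 0" by (simp add: d_def)
  have d_nonneg: "d k \<ge> 0" for k using mono by (simp add: d_def fdiff_def)
  have d_Turan: "d k * d (Suc (Suc k)) \<le> (d (Suc k))\<^sup>2" for k
    unfolding d_def by (intro real_rooted_jensen_Turan real_rooted_jensen_fdiff rr)
  \<comment> \<open>The differences arise from \<open>\<gamma>\<close> by a unimodular substitution in the homogeneous cubic, which
    leaves the discriminant unchanged.\<close>
  have cubic: "(d k * (d (k + 1) - d k) - \<gamma> k * (d (k + 2) - 2 * d (k + 1) + d k))\<^sup>2
      \<le> 4 * ((d k)\<^sup>2 + \<gamma> k * (d k - d (k + 1))) * ((d (k + 1))\<^sup>2 - d k * d (k + 2))" for k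
  proof -
    define g d0 d1 d2 where "g = \<gamma> k" and "d0 = d k" and "d1 = d (k + 1)" and "d2 = d (k + 2)"
    have g: "\<gamma> (k + 1) = g + d0" "\<gamma> (k + 2) = g + d0 + d1" "\<gamma> (k + 3) = g + d0 + d1 + d2"
      by (simp_all add: g_def d0_def d1_def d2_def d_def fdiff_def numeral_3_eq_3)
    have "\<gamma> (k + 3) \<noteq> 0" using pos by (metis less_irrefl)
    from real_rooted_jensen_cubic[OF rr this]
    have "((g + d0) * (g + d0 + d1) - g * (g + d0 + d1 + d2))\<^sup>2
      \<le> 4 * ((g + d0)\<^sup>2 - g * (g + d0 + d1)) * ((g + d0 + d1)\<^sup>2 - (g + d0) * (g + d0 + d1 + d2))"
      unfolding g g_def[symmetric] .
    moreover have "4 * ((g + d0)\<^sup>2 - g * (g + d0 + d1)) * ((g + d0 + d1)\<^sup>2 - (g + d0) * (g + d0 + d1 + d2))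
        - ((g + d0) * (g + d0 + d1) - g * (g + d0 + d1 + d2))\<^sup>2
      = 4 * (d0\<^sup>2 + g * (d0 - d1)) * (d1\<^sup>2 - d0 * d2) - (d0 * (d1 - d0) - g * (d2 - 2 * d1 + d0))\<^sup>2"
      by algebra
    ultimately show ?thesis
      unfolding g_def[symmetric] d0_def[symmetric] d1_def[symmetric] d2_def[symmetric] by linarith
  qed
  have d_pos: "d k > 0" for k
  proof (induction k)
    case 0
    then show ?case using descent d_nonneg[of 1] by simp
  next
    case (Suc k)
    show ?case
    proof (rule ccontr)
      assume "\<not> d (Suc k) > 0"
      then have z1: "d (k + 1) = 0" using d_nonneg[of "Suc k"] by simp
      then have z2: "d (k + 2) = 0"
        using d_Turan[of k] Suc d_nonneg[of "k + 2"] by (simp add: mult_le_0_iff)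
      have "(d k * (0 - d k) - \<gamma> k * (0 - 2 * 0 + d k))\<^sup>2 \<le> 0"
        using cubic[of k] unfolding z1 z2 by simp
      then have "d k * (d k + \<gamma> k) = 0" by (simp add: algebra_simps)
      then show False using Suc pos[of k] by simp
    qed
  qed
  define r where "r k = d (Suc k) / d k" for k
  define u where "u k = d k / \<gamma> k" for k
  have r_nonneg: "r k \<ge> 0" for k using d_nonneg by (simp add: r_def)
  have r_dec: "r (Suc k) \<le> r k" for k
    using d_Turan[of k] d_pos[of k] d_pos[of "Suc k"]
    by (simp add: r_def divide_simps power2_eq_square mult.commute)
  then have "decseq r" by (simp add: decseq_Suc_iff)
  then obtain \<rho> where \<rho>: "r \<longlonglongrightarrow> \<rho>"
    using decseq_convergent[of r 0] r_nonneg by blast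
  have r0: "r 0 < 1" using descent d_pos[of 0] by (simp add: r_def)
  have r_le: "r k \<le> r 0" for k using \<open>decseq r\<close> by (simp add: decseq_def)
  then have "\<rho> \<le> r 0" using \<rho> by (intro LIMSEQ_le_const2) auto
  then have "\<rho> < 1" using r0 by simp
  have d_le: "d k \<le> d 0 * r 0 ^ k" for k
  proof (induction k)
    case (Suc k)
    have "d (Suc k) = d k * r k" using d_pos[of k] by (simp add: r_def)
    also have "\<dots> \<le> d 0 * r 0 ^ k * r 0"
      using Suc r_le r_nonneg d_nonneg by (intro mult_mono) auto
    finally show ?case by (simp add: mult_ac)
  qed simp
  have \<gamma>_le: "\<gamma> 0 \<le> \<gamma> k" for k
    by (induction k) (use mono order_trans in auto)
  have "u \<longlonglongrightarrow> 0"
  proof (rule tendsto_sandwich)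
    show "\<forall>\<^sub>F k in sequentially. 0 \<le> u k"
      using d_nonneg pos by (auto simp: u_def less_imp_le intro!: always_eventually)
    have "u k \<le> d 0 / \<gamma> 0 * r 0 ^ k" for k
    proof -
      have "u k \<le> (d 0 * r 0 ^ k) / \<gamma> 0"
        unfolding u_def using d_le d_nonneg pos \<gamma>_le r_nonneg by (intro frac_le) auto
      then show ?thesis by simp
    qed
    then show "\<forall>\<^sub>F k in sequentially. u k \<le> d 0 / \<gamma> 0 * r 0 ^ k" by simp
    have "(\<lambda>k. r 0 ^ k) \<longlonglongrightarrow> 0"
      using r0 r_nonneg[of 0] by (intro LIMSEQ_power_zero) auto
    then show "(\<lambda>k. d 0 / \<gamma> 0 * r 0 ^ k) \<longlonglongrightarrow> 0" by (rule tendsto_mult_right_zero)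
  qed auto
  have scaled: "(u k * (r k - 1) - (r k * r (Suc k) - 2 * r k + 1))\<^sup>2
      \<le> 4 * ((u k)\<^sup>2 + u k * (1 - r k)) * ((r k)\<^sup>2 - r k * r (Suc k))" for k
  proof -
    define g D where "g = \<gamma> k" and "D = d k"
    have gD: "g > 0" "D > 0" using pos d_pos by (auto simp: g_def D_def)
    have uD: "D = u k * g" using gD by (simp add: u_def g_def D_def)
    have d1: "d (k + 1) = r k * D" and d2: "d (k + 2) = r k * r (Suc k) * D"
      using d_pos[of k] d_pos[of "Suc k"] by (simp_all add: r_def D_def)
    have "(D * (r k * D - D) - g * (r k * r (Suc k) * D - 2 * (r k * D) + D))\<^sup>2
      \<le> 4 * (D\<^sup>2 + g * (D - r k * D)) * ((r k * D)\<^sup>2 - D * (r k * r (Suc k) * D))"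
      using cubic[of k] unfolding d1 d2 g_def[symmetric] D_def[symmetric] .
    also have "(D * (r k * D - D) - g * (r k * r (Suc k) * D - 2 * (r k * D) + D))\<^sup>2
        = (g * D)\<^sup>2 * (u k * (r k - 1) - (r k * r (Suc k) - 2 * r k + 1))\<^sup>2"
      unfolding uD by algebra
    also have "4 * (D\<^sup>2 + g * (D - r k * D)) * ((r k * D)\<^sup>2 - D * (r k * r (Suc k) * D))
        = (g * D)\<^sup>2 * (4 * ((u k)\<^sup>2 + u k * (1 - r k)) * ((r k)\<^sup>2 - r k * r (Suc k)))"
      unfolding uD by algebra
    finally show ?thesis using gD by (simp add: mult_le_cancel_left_pos)
  qed
  have r': "(\<lambda>k. r (Suc k)) \<longlonglongrightarrow> \<rho>" using \<rho> by (rule LIMSEQ_Suc)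
  have "(\<lambda>k. (u k * (r k - 1) - (r k * r (Suc k) - 2 * r k + 1))\<^sup>2)
      \<longlonglongrightarrow> (0 * (\<rho> - 1) - (\<rho> * \<rho> - 2 * \<rho> + 1))\<^sup>2"
    by (intro tendsto_intros \<rho> r' \<open>u \<longlonglongrightarrow> 0\<close>)
  moreover have "(\<lambda>k. 4 * ((u k)\<^sup>2 + u k * (1 - r k)) * ((r k)\<^sup>2 - r k * r (Suc k)))
      \<longlonglongrightarrow> 4 * (0\<^sup>2 + 0 * (1 - \<rho>)) * (\<rho>\<^sup>2 - \<rho> * \<rho>)"
    by (intro tendsto_intros \<rho> r' \<open>u \<longlonglongrightarrow> 0\<close>)
  ultimately have "(0 * (\<rho> - 1) - (\<rho> * \<rho> - 2 * \<rho> + 1))\<^sup>2 \<le> 4 * (0\<^sup>2 + 0 * (1 - \<rho>)) * (\<rho>\<^sup>2 - \<rho> * \<rho>)"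
    using scaled by (intro LIMSEQ_le) auto
  then have "\<rho> * \<rho> - 2 * \<rho> + 1 = 0" by simp
  then have "(1 - \<rho>)\<^sup>2 = 0" by (simp add: power2_eq_square algebra_simps)
  then show False using \<open>\<rho> < 1\<close> by simp
qed

lemma fdiff_nondecreasing:
  assumes pos: "\<And>k. \<gamma> k > 0" and mono: "\<And>k. \<gamma> k \<le> \<gamma> (Suc k)" and rr: "real_rooted_jensen \<gamma>"
  shows "fdiff \<gamma> k \<le> fdiff \<gamma> (Suc k)"
proof -
  have "fdiff (\<lambda>i. \<gamma> (k + i)) 0 \<le> fdiff (\<lambda>i. \<gamma> (k + i)) 1"
    using assms by (intro fdiff_nondecreasing_at_0 real_rooted_jensen_shift) auto
  then show ?thesis by (simp add: fdiff_def)
qed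

text \<open>The hypotheses pass from \<open>\<gamma>\<close> to its difference sequence \<open>d\<close>, unless \<open>d\<close> is the zero sequence:
by log-concavity of \<open>\<gamma>\<close>, one vanishing difference makes the next one vanish as well.\<close>

lemma iterated_fdiff_at_0_nonneg:
  assumes "\<And>k. \<gamma> k > 0" and "\<And>k. \<gamma> k \<le> \<gamma> (Suc k)" and "real_rooted_jensen \<gamma>"
  shows "iterated_fdiff_at_0 \<gamma> j \<ge> 0"
  using assms
proof (induction j arbitrary: \<gamma>)
  case 0
  then show ?case by (simp add: iterated_fdiff_at_0_def less_imp_le)
next
  case (Suc j)
  note pos = Suc.prems(1) and rr = Suc.prems(3)
  define d where "d = fdiff \<gamma>"
  have step: "iterated_fdiff_at_0 \<gamma> (Suc j) = iterated_fdiff_at_0 d j"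
    by (simp add: iterated_fdiff_at_0_def d_def funpow_swap1)
  have nonneg: "d k \<ge> 0" for k using Suc.prems(2) by (simp add: d_def fdiff_def)
  have mono: "d k \<le> d (Suc k)" for k
    unfolding d_def using Suc.prems by (rule fdiff_nondecreasing)
  show ?case
  proof (cases "d 0 = 0")
    case True
    have "d k = 0" for k
    proof (induction k)
      case (Suc k)
      then have "\<gamma> (Suc k) = \<gamma> k" by (simp add: d_def fdiff_def)
      then have "\<gamma> (Suc (Suc k)) \<le> \<gamma> (Suc k)"
        using real_rooted_jensen_Turan[OF rr, of k] pos[of k]
        by (simp add: power2_eq_square)
      then show ?case using nonneg[of "Suc k"] by (simp add: d_def fdiff_def)
    qed (fact True)
    then have "d = (\<lambda>_. 0)" by auto
    moreover have "(fdiff ^^ i) (\<lambda>_. 0) = (\<lambda>_. 0)" for i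
      by (induction i) (simp_all add: fdiff_def)
    ultimately show ?thesis unfolding step by (simp add: iterated_fdiff_at_0_def)
  next
    case False
    then have "d 0 > 0" using nonneg[of 0] by simp
    moreover have "d 0 \<le> d k" for k
      by (induction k) (use mono order_trans in auto)
    ultimately have "d k > 0" for k by (rule less_le_trans)
    then show ?thesis
      unfolding step using mono real_rooted_jensen_fdiff Suc.prems(3)
      by (intro Suc.IH) (auto simp: d_def)
  qed
qed

lemma real_rooted_jensen_mono_if_two_step_mono:
  assumes pos: "\<And>k. \<gamma> k > 0" and two: "\<And>k. \<gamma> k \<le> \<gamma> (k + 2)" and rr: "real_rooted_jensen \<gamma>"
  shows "\<gamma> k \<le> \<gamma> (Suc k)"
proof (rule ccontr)
  assume "\<not> \<gamma> k \<le> \<gamma> (Suc k)"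
  then have "\<gamma> (Suc k) * \<gamma> (Suc k) < \<gamma> k * \<gamma> (k + 2)"
    using pos[of "Suc k"] two[of k] pos[of k] by (intro mult_less_le_imp_less) auto
  then show False
    using real_rooted_jensen_Turan[OF rr, of k] by (simp add: power2_eq_square)
qed

section \<open>Hermite polynomials and the Hermite diagonal operator\<close>

lemma coeff_hermite:
  "coeff (hermite n) m =
     (if m \<le> n \<and> even (n - m)
      then (- 1) ^ ((n - m) div 2) * fact n * 2 ^ m / (fact ((n - m) div 2) * fact m) else 0)"
proof -
  define h :: "nat \<Rightarrow> real" where "h k = (- 1) ^ k * fact n * 2 ^ m / (fact k * fact m)" for k
  have "coeff (hermite n) m = (\<Sum>k\<le>n div 2. if n - 2 * k = m then h k else 0)"
    by (auto simp: hermite_def coeff_sum h_def intro!: sum.cong)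
  also have "\<dots> = (\<Sum>k\<in>{k. k \<le> n div 2 \<and> n - 2 * k = m}. h k)"
    by (simp add: sum.inter_filter[symmetric])
  also have "{k. k \<le> n div 2 \<and> n - 2 * k = m} = (if m \<le> n \<and> even (n - m) then {(n - m) div 2} else {})"
  proof -
    have "k \<le> n div 2 \<and> n - 2 * k = m \<longleftrightarrow> (m \<le> n \<and> even (n - m)) \<and> k = (n - m) div 2" for k
    proof
      assume k: "k \<le> n div 2 \<and> n - 2 * k = m"
      then have "n = m + 2 * k" by auto
      then show "(m \<le> n \<and> even (n - m)) \<and> k = (n - m) div 2" by simp
    next
      assume m: "(m \<le> n \<and> even (n - m)) \<and> k = (n - m) div 2"
      then have "n = m + 2 * k" by auto
      then show "k \<le> n div 2 \<and> n - 2 * k = m" by simp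
    qed
    then show ?thesis by auto
  qed
  finally show ?thesis by (auto simp: h_def)
qed

lemma coeff_hermite_top: "coeff (hermite n) n = 2 ^ n"
  by (simp add: coeff_hermite)

lemma degree_hermite_le: "degree (hermite n) \<le> n"
  by (rule degree_le) (simp add: coeff_hermite)

text \<open>The operator \<open>x - D/2\<close>; up to the factor \<open>2\<close> it is the raising operator of the Hermite polynomials.\<close>

definition hermite_raise :: "'a :: field_char_0 poly \<Rightarrow> 'a poly" where
  "hermite_raise p = pCons 0 p - smult (1 / 2) (pderiv p)"

lemma hermite_raise_hermite: "hermite_raise (hermite n) = smult (1 / 2) (hermite (Suc n))"
proof (rule poly_eqI)
  fix m
  have raise: "2 * coeff (hermite_raise (hermite n)) m
      = 2 * (if m = 0 then 0 else coeff (hermite n) (m - 1)) - (real m + 1) * coeff (hermite n) (Suc m)"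
    by (cases m) (simp_all add: hermite_raise_def coeff_pderiv)
  have "2 * coeff (hermite_raise (hermite n)) m = coeff (hermite (Suc n)) m"
  proof (cases "m \<le> Suc n \<and> even (Suc n - m)")
    case False
    then have "\<not> (Suc m \<le> n \<and> even (n - Suc m))" by auto
    moreover have "m = 0 \<or> \<not> (m - 1 \<le> n \<and> even (n - (m - 1)))"
      using False by (cases m) auto
    ultimately show ?thesis using False unfolding raise by (auto simp: coeff_hermite)
  next
    case True
    then obtain k where k: "Suc n = m + 2 * k"
      by (metis evenE le_add_diff_inverse)
    show ?thesis
    proof (cases k)
      case 0
      then show ?thesis using k unfolding raise
        by (auto simp: coeff_hermite)
    next
      case (Suc i)
      then have n: "n = m + 2 * i + 1" using k by simp
      have "n - Suc m = 2 * i" "Suc m \<le> n" "Suc n - m = 2 * Suc i" "m \<le> Suc n" using n by auto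
      then have 1: "coeff (hermite n) (Suc m) = (- 1) ^ i * fact n * 2 ^ Suc m / (fact i * fact (Suc m))"
        and 2: "coeff (hermite (Suc n)) m = (- 1) ^ Suc i * fact (Suc n) * 2 ^ m / (fact (Suc i) * fact m)"
        by (simp_all add: coeff_hermite)
      have rn: "real n = real m + 2 * real i + 1" using n by simp
      have fm: "fact (Suc m) = (real m + 1) * fact m" and fi: "fact (Suc i) = (real i + 1) * fact i"
        and fn: "fact (Suc n) = (real m + 2 * real i + 2) * fact n"
        by (simp_all add: rn algebra_simps)
      have nz: "real m + 1 \<noteq> 0" "real i + 1 \<noteq> 0" by linarith+
      have *: "(real m + 1) * coeff (hermite n) (Suc m) = (- 1) ^ i * fact n * 2 ^ Suc m / (fact i * fact m)"
        unfolding 1 fm using nz by (simp add: divide_simps)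
      have **: "coeff (hermite (Suc n)) m
          = - ((real m + 2 * real i + 2) * ((- 1) ^ i * fact n * 2 ^ m / ((real i + 1) * fact i * fact m)))"
        unfolding 2 fi fn by simp
      have ***: "2 * (if m = 0 then 0 else coeff (hermite n) (m - 1))
          = - (real m * ((- 1) ^ i * fact n * 2 ^ m / ((real i + 1) * fact i * fact m)))"
      proof (cases m)
        case (Suc l)
        have "n - l = 2 * Suc i" "l \<le> n" using n Suc by auto
        define X where "X = (- 1) ^ i * fact n * 2 ^ l / ((real i + 1) * fact i * fact l :: real)"
        have "coeff (hermite n) l = (- 1) ^ Suc i * fact n * 2 ^ l / (fact (Suc i) * fact l)"
          using \<open>n - l = 2 * Suc i\<close> \<open>l \<le> n\<close> by (simp add: coeff_hermite)
        then have c: "coeff (hermite n) l = - X"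
          unfolding fi X_def by simp
        have "fact m = (real l + 1) * fact l" and "(2 :: real) ^ m = 2 * 2 ^ l"
          using Suc by (simp_all add: algebra_simps)
        then have e: "(- 1) ^ i * fact n * 2 ^ m / ((real i + 1) * fact i * fact m) = 2 * X / (real l + 1)"
          unfolding X_def by (simp add: mult_ac)
        have "real m = real l + 1" and "real l + 1 \<noteq> 0" using Suc by simp_all
        then have "real m * (2 * X / (real l + 1)) = 2 * X" by simp
        then show ?thesis unfolding e using Suc c by (simp only:) simp
      qed simp
      define Y where "Y = (- 1) ^ i * fact n * 2 ^ m / ((real i + 1) * fact i * fact m)"
      have "(- 1) ^ i * fact n * 2 ^ Suc m / (fact i * fact m) = 2 * (real i + 1) * Y"
      proof -
        have cancel: "2 * k * (B / (k * C * D)) = 2 * B / (C * D)" if "k \<noteq> 0" for k B C D :: real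
          using that by simp
        show ?thesis
          unfolding Y_def cancel[OF nz(2)] by simp
      qed
      then show ?thesis unfolding raise * ** *** Y_def[symmetric] by (simp add: algebra_simps)
    qed
  qed
  then show "coeff (hermite_raise (hermite n)) m = coeff (smult (1 / 2) (hermite (Suc n))) m" by simp
qed

lemma pderiv_hermite: "pderiv (hermite (Suc n)) = smult (2 * of_nat (Suc n)) (hermite n)"
  by (rule poly_eqI) (auto simp: coeff_pderiv coeff_hermite field_simps simp del: of_nat_Suc)

lemma pderiv_hermite_0: "pderiv (hermite 0) = 0"
  by (simp add: hermite_def monom_0)

lemma higher_pderiv_hermite:
  "(pderiv ^^ j) (hermite (m + j)) = smult (2 ^ j * fact (m + j) / fact m) (hermite m)"
proof (induction j)
  case (Suc j)
  have "(pderiv ^^ Suc j) (hermite (m + Suc j)) = (pderiv ^^ j) (pderiv (hermite (Suc (m + j))))"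
    by (simp add: funpow_swap1)
  also have "\<dots> = smult (2 * of_nat (Suc (m + j)) * (2 ^ j * fact (m + j) / fact m)) (hermite m)"
    unfolding pderiv_hermite higher_pderiv_smult Suc.IH by simp
  also have "2 * of_nat (Suc (m + j)) * (2 ^ j * fact (m + j) / fact m) = 2 ^ Suc j * fact (m + Suc j) / (fact m :: real)"
    by (simp add: field_simps)
  finally show ?case .
qed simp

lemma hermite_raise_smult: "hermite_raise (smult c p) = smult c (hermite_raise p)"
  by (simp add: hermite_raise_def pderiv_smult smult_diff_right mult.commute)

lemma hermite_raise_add: "hermite_raise (p + q) = hermite_raise p + hermite_raise q"
  by (simp add: hermite_raise_def pderiv_add smult_add_right)

lemma hermite_raise_funpow_smult: "(hermite_raise ^^ j) (smult c p) = smult c ((hermite_raise ^^ j) p)"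
  by (induction j) (simp_all add: hermite_raise_smult)

lemma hermite_raise_funpow_add:
  "(hermite_raise ^^ j) (p + q) = (hermite_raise ^^ j) p + (hermite_raise ^^ j) q"
  by (induction j) (simp_all add: hermite_raise_add)

lemma hermite_raise_funpow_hermite:
  "(hermite_raise ^^ j) (hermite m) = smult (1 / 2 ^ j) (hermite (m + j))"
  by (induction j) (simp_all add: hermite_raise_smult hermite_raise_hermite mult.commute)

text \<open>The factor on the right is the falling factorial \<open>n (n - 1) ... (n - j + 1)\<close>: the Hermite polynomials
are to \<open>(x - D/2)^j D^j\<close> what the monomials are to \<open>x^j D^j\<close>.\<close>

lemma hermite_number_falling_factorial:
  assumes "j \<le> n"
  shows "(hermite_raise ^^ j) ((pderiv ^^ j) (hermite n)) = smult (fact j * of_nat (n choose j)) (hermite n)"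
proof -
  obtain m where n: "n = m + j" using that[of "n - j"] assms by simp
  have "fact (m + j) / fact m = fact j * (real (m + j choose j))"
    using binomial_fact[of j "m + j", where 'a = real] by simp
  then show ?thesis
    by (simp add: n higher_pderiv_hermite hermite_raise_funpow_smult hermite_raise_funpow_hermite)
qed

lemma higher_pderiv_hermite_eq_0:
  assumes "n < j" shows "(pderiv ^^ j) (hermite n) = 0"
proof -
  obtain i where "j = Suc i + n" using that[of "j - n - 1"] assms by simp
  then have "(pderiv ^^ j) (hermite n) = (pderiv ^^ Suc i) ((pderiv ^^ n) (hermite (0 + n)))"
    by (simp add: funpow_add)
  also have "\<dots> = 0"
    unfolding higher_pderiv_hermite funpow_Suc_right o_apply pderiv_smult pderiv_hermite_0 by simp
  finally show ?thesis .
qed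

lemma hermite_expansion:
  assumes "degree p \<le> n" shows "\<exists>c. p = (\<Sum>k\<le>n. smult (c k) (hermite k))"
  using assms
proof (induction n arbitrary: p)
  case 0
  then obtain a where "p = [:a:]" by (metis degree_eq_zeroE le_zero_eq)
  then have "p = (\<Sum>k\<le>0. smult ((\<lambda>_. a) k) (hermite k))" by (simp add: hermite_def monom_0)
  then show ?case by (rule exI[of _ "\<lambda>_. a"])
next
  case (Suc n)
  define a where "a = coeff p (Suc n) / 2 ^ Suc n"
  have "degree (p - smult a (hermite (Suc n))) \<le> n"
  proof (rule degree_le, intro allI impI)
    fix i assume "n < i"
    then show "coeff (p - smult a (hermite (Suc n))) i = 0"
      using Suc.prems degree_hermite_le[of "Suc n"]
      by (cases "i = Suc n") (auto simp: a_def coeff_hermite_top coeff_eq_0 simp del: power_Suc)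
  qed
  then obtain c where "p - smult a (hermite (Suc n)) = (\<Sum>k\<le>n. smult (c k) (hermite k))"
    using Suc.IH by blast
  then have "p = (\<Sum>k\<le>Suc n. smult ((c(Suc n := a)) k) (hermite k))"
    by (simp add: diff_eq_eq)
  then show ?case by (rule exI[of _ "c(Suc n := a)"])
qed

lemma newton_forward_difference:
  "\<gamma> n = (\<Sum>j\<le>n. of_nat (n choose j) * iterated_fdiff_at_0 \<gamma> j)"
proof -
  have "jensen_form n \<gamma> 1 0 = (\<Sum>k\<le>n. if k = n then complex_of_real (\<gamma> k) else 0)"
    unfolding jensen_form_def by (intro sum.cong) auto
  also have "\<dots> = of_real (\<gamma> n)" by simp
  finally have "complex_of_real (\<gamma> n) = of_real (\<Sum>j\<le>n. of_nat (n choose j) * iterated_fdiff_at_0 \<gamma> j)"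
    by (subst (asm) jensen_form_iterated_fdiff) (simp add: jensen_form_def)
  then show ?thesis by (simp only: of_real_eq_iff)
qed

text \<open>Both sides are linear in \<open>p\<close>; on Hermite polynomials this is Newton's forward difference formula.\<close>

lemma hermite_diagonal_operator_formula:
  assumes diag: "diagonal_operator hermite \<gamma> T" and deg: "degree p \<le> n"
  shows "T p = (\<Sum>j\<le>n. smult (iterated_fdiff_at_0 \<gamma> j / fact j)
                  ((hermite_raise ^^ j) ((pderiv ^^ j) p)))"
proof -
  define \<Psi> where "\<Psi> p = (\<Sum>j\<le>n. smult (iterated_fdiff_at_0 \<gamma> j / fact j)
                  ((hermite_raise ^^ j) ((pderiv ^^ j) p)))" for p
  have lin: "poly_linear T" and T: "\<And>k. T (hermite k) = smult (\<gamma> k) (hermite k)"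
    using diag by (auto simp: diagonal_operator_def)
  have lin\<Psi>: "poly_linear \<Psi>"
    unfolding poly_linear_iff \<Psi>_def
    by (simp add: higher_pderiv_add higher_pderiv_smult hermite_raise_funpow_add
        hermite_raise_funpow_smult smult_add_right sum.distrib smult_sum_distrib mult_ac)
  have "\<Psi> (hermite k) = smult (\<gamma> k) (hermite k)" if "k \<le> n" for k
  proof -
    have "\<Psi> (hermite k) = (\<Sum>j\<le>k. smult (iterated_fdiff_at_0 \<gamma> j / fact j)
                  ((hermite_raise ^^ j) ((pderiv ^^ j) (hermite k))))"
      unfolding \<Psi>_def
    proof (rule sum.mono_neutral_right)
      have "(hermite_raise ^^ j) (0 :: real poly) = 0" for j
        using hermite_raise_funpow_smult[of j 0 0] by simp
      then show "\<forall>j\<in>{..n} - {..k}. smult (iterated_fdiff_at_0 \<gamma> j / fact j)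
                  ((hermite_raise ^^ j) ((pderiv ^^ j) (hermite k))) = 0"
        by (simp add: higher_pderiv_hermite_eq_0)
    qed (use that in auto)
    also have "\<dots> = (\<Sum>j\<le>k. smult (of_nat (k choose j) * iterated_fdiff_at_0 \<gamma> j) (hermite k))"
      by (intro sum.cong) (auto simp: hermite_number_falling_factorial mult.commute)
    also have "\<dots> = smult (\<gamma> k) (hermite k)"
      by (subst (2) newton_forward_difference) (simp add: smult_sum)
    finally show ?thesis .
  qed
  moreover obtain c where "p = (\<Sum>k\<le>n. smult (c k) (hermite k))"
    using hermite_expansion[OF deg] by blast
  ultimately have "T p = \<Psi> p"
    by (simp add: poly_linear_sum[OF lin] poly_linear_sum[OF lin\<Psi>] poly_linear_smult[OF lin]
        poly_linear_smult[OF lin\<Psi>] T)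
  then show ?thesis by (simp add: \<Psi>_def)
qed

lemma coeffs_hermite_combination:
  fixes n :: nat and f :: "nat \<Rightarrow> real"
  defines "p \<equiv> (\<Sum>k\<le>Suc (Suc n). smult (f k) (hermite k))"
  shows "coeff p (Suc (Suc n)) = f (Suc (Suc n)) * 2 ^ (n + 2)"
    and "coeff p (Suc n) = f (Suc n) * 2 ^ (n + 1)"
    and "coeff p n = f n * 2 ^ n - f (Suc (Suc n)) * (2 ^ n * (real n + 1) * (real n + 2))"
    and "degree p \<le> Suc (Suc n)"
proof -
  have low: "(\<Sum>k\<le>i. f k * coeff (hermite k) j) = 0" if "i < j" for i j
    using that by (intro sum.neutral) (auto simp: coeff_hermite)
  have top: "(\<Sum>k\<le>i. f k * coeff (hermite k) i) = f i * 2 ^ i" for i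
    by (cases i) (simp_all add: low coeff_hermite_top del: power_Suc)
  have "coeff (hermite (Suc n)) n = 0" by (simp add: coeff_hermite)
  moreover have "coeff (hermite (Suc (Suc n))) n = - (2 ^ n * (real n + 1) * (real n + 2))"
    by (simp add: coeff_hermite field_simps)
  moreover have "coeff (hermite (Suc n)) (Suc (Suc n)) = 0" by (simp add: coeff_hermite)
  moreover have "coeff (hermite (Suc (Suc n))) (Suc n) = 0" by (simp add: coeff_hermite)
  ultimately show "coeff p (Suc (Suc n)) = f (Suc (Suc n)) * 2 ^ (n + 2)"
    and "coeff p (Suc n) = f (Suc n) * 2 ^ (n + 1)"
    and "coeff p n = f n * 2 ^ n - f (Suc (Suc n)) * (2 ^ n * (real n + 1) * (real n + 2))"
    by (simp_all add: p_def coeff_sum low top coeff_hermite_top)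
  show "degree p \<le> Suc (Suc n)"
    unfolding p_def
    by (intro degree_sum_le) (auto intro!: order_trans[OF degree_smult_le] order_trans[OF degree_hermite_le])
qed

text \<open>The three top coefficients of \<open>T[x^(n+2)]\<close> are \<open>\<gamma> (n + 2)\<close>, \<open>0\<close> and
\<open>(n + 1) (n + 2) (\<gamma> n - \<gamma> (n + 2)) / 4\<close>. They alone survive \<open>n\<close> differentiations, and the resulting
quadratic has real zeros only if the first and the last do not have the same sign.\<close>

lemma two_step_mono_if_only_real_zeros:
  assumes diag: "diagonal_operator hermite \<gamma> T" and pos: "\<gamma> (n + 2) > 0"
    and rz: "only_real_zeros (T (monom 1 (n + 2)))"
  shows "\<gamma> n \<le> \<gamma> (n + 2)"
proof -
  have lin: "poly_linear T" and T: "\<And>k. T (hermite k) = smult (\<gamma> k) (hermite k)"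
    using diag by (auto simp: diagonal_operator_def)
  have "degree (monom (1 :: real) (n + 2)) \<le> Suc (Suc n)"
    using degree_monom_le[of "1 :: real" "n + 2"] by simp
  then obtain c where c: "monom 1 (n + 2) = (\<Sum>k\<le>Suc (Suc n). smult (c k) (hermite k))"
    using hermite_expansion by blast
  note mono_coeffs = coeffs_hermite_combination[where f = c and n = n, folded c]
  define q where "q = T (monom 1 (n + 2))"
  have q: "q = (\<Sum>k\<le>Suc (Suc n). smult (\<gamma> k * c k) (hermite k))"
    unfolding q_def c
    by (simp only: poly_linear_sum[OF lin] poly_linear_smult[OF lin] T smult_smult mult.commute)
  note q_coeffs = coeffs_hermite_combination[where f = "\<lambda>k. \<gamma> k * c k" and n = n, folded q]
  have c2: "c (Suc (Suc n)) * 2 ^ (n + 2) = 1" and c1: "c (Suc n) = 0"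
    and c0: "c n * 2 ^ n = c (Suc (Suc n)) * (2 ^ n * (real n + 1) * (real n + 2))"
    using mono_coeffs(1-3) by simp_all
  have top: "coeff q (Suc (Suc n)) = \<gamma> (n + 2)"
    using q_coeffs(1) c2 by (metis add_2_eq_Suc' mult.assoc mult.right_neutral)
  have mid: "coeff q (Suc n) = 0" using q_coeffs(2) c1 by simp
  have c2': "c (Suc (Suc n)) * 2 ^ n = 1 / 4" using c2 by simp
  have bot: "coeff q n = (\<gamma> n - \<gamma> (n + 2)) * ((real n + 1) * (real n + 2) / 4)"
  proof -
    have "coeff q n = (\<gamma> n - \<gamma> (n + 2)) * (c (Suc (Suc n)) * 2 ^ n * ((real n + 1) * (real n + 2)))"
      using q_coeffs(3) c0 by (simp add: algebra_simps)
    then show ?thesis unfolding c2' by simp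
  qed
  \<comment> \<open>The positive factors by which \<open>n\<close> differentiations scale the coefficients of index \<open>n\<close> and \<open>n + 2\<close>.\<close>
  define P0 P2 where "P0 = pochhammer (1 :: real) n" and "P2 = pochhammer (3 :: real) n"
  have P: "P0 > 0" "P2 > 0" by (simp_all add: P0_def P2_def pochhammer_pos)
  have "(pderiv ^^ n) q = [:P0 * coeff q n, 2 * 0, P2 * \<gamma> (n + 2):]"
  proof (rule poly_eqI)
    fix k :: nat
    have "k = 0 \<or> k = 1 \<or> k = 2 \<or> k > 2" by arith
    then show "coeff ((pderiv ^^ n) q) k = coeff [:P0 * coeff q n, 2 * 0, P2 * \<gamma> (n + 2):] k"
      using q_coeffs(4) top mid
      by (auto simp: coeff_higher_pderiv P0_def P2_def coeff_pCons coeff_eq_0 numeral_2_eq_2 split: nat.splits)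
  qed
  moreover have "only_real_zeros ((pderiv ^^ n) q)"
    using rz by (intro only_real_zeros_higher_pderiv) (simp add: q_def)
  ultimately have "P0 * coeff q n * (P2 * \<gamma> (n + 2)) \<le> 0\<^sup>2"
    using only_real_zeros_quadratic by metis
  then have "coeff q n \<le> 0"
    using P pos by (auto simp: mult_le_0_iff)
  moreover have "(real n + 1) * (real n + 2) / 4 > 0" by simp
  ultimately show ?thesis unfolding bot by (simp add: mult_le_0_iff)
qed

section \<open>Polynomials in two variables without zeros in the product of upper half-planes\<close>

text \<open>A polynomial in two variables \<open>x\<close> and \<open>y\<close> is a polynomial in \<open>y\<close> whose coefficients are polynomials
in \<open>x\<close>. So \<open>pderiv\<close> differentiates in \<open>y\<close>, \<open>poly F [:y:]\<close> is the polynomial in \<open>x\<close> for a fixed value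
of \<open>y\<close>, and \<open>pCons 0\<close> multiplies by \<open>y\<close>.\<close>

definition dx :: "complex poly poly \<Rightarrow> complex poly poly" where
  "dx F = map_poly pderiv F"

text \<open>The operator \<open>2 D_x D_y + D_y^2\<close>.\<close>

definition coupling :: "complex poly poly \<Rightarrow> complex poly poly" where
  "coupling F = pderiv (dx F) + pderiv (dx F) + pderiv (pderiv F)"

abbreviation diag :: "complex poly poly \<Rightarrow> complex poly" where
  "diag F \<equiv> poly F [:0, 1:]"

lemma coeff_dx: "coeff (dx F) j = pderiv (coeff F j)"
  by (simp add: dx_def coeff_map_poly)

lemma dx_simps [simp]:
  "dx 0 = 0" "dx (pCons a F) = pCons (pderiv a) (dx F)" "dx (F + G) = dx F + dx G"
  "dx (smult [:c:] F) = smult [:c:] (dx F)"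
  by (rule poly_eqI; simp add: coeff_dx coeff_pCons pderiv_add pderiv_smult split: nat.splits)+

lemma dx_pderiv: "dx (pderiv F) = pderiv (dx F)"
proof (rule poly_eqI)
  have "pderiv (of_nat n * p) = of_nat n * pderiv p" for n and p :: "complex poly"
    by (simp add: of_nat_poly pderiv_smult)
  then show "coeff (dx (pderiv F)) j = coeff (pderiv (dx F)) j" for j
    by (simp only: coeff_dx coeff_pderiv)
qed

lemma pderiv_poly_substitution:
  "pderiv (poly F q) = poly (dx F) q + poly (pderiv F) q * pderiv q"
  by (induction F) (simp_all add: pderiv_pCons pderiv_add pderiv_mult algebra_simps)

lemma diag_smult: "diag (smult [:c:] F) = smult c (diag F)"
  by simp

lemma coupling_0 [simp]: "coupling 0 = 0"
  by (simp add: coupling_def)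

lemma coupling_add: "coupling (F + G) = coupling F + coupling G"
  by (simp add: coupling_def pderiv_add algebra_simps)

lemma coupling_smult: "coupling (smult [:c:] F) = smult [:c:] (coupling F)"
  by (simp add: coupling_def pderiv_smult smult_add_right)

lemma coupling_sum: "coupling (sum f I) = (\<Sum>i\<in>I. coupling (f i))"
  by (induction I rule: infinite_finite_induct) (simp_all add: coupling_add)

lemma coupling_funpow_add: "(coupling ^^ k) (F + G) = (coupling ^^ k) F + (coupling ^^ k) G"
  by (induction k) (simp_all add: coupling_add)

lemma coupling_funpow_smult: "(coupling ^^ k) (smult [:c:] F) = smult [:c:] ((coupling ^^ k) F)"
  by (induction k) (simp_all add: coupling_smult del: smult_pCons)

lemma coupling_funpow_0 [simp]: "(coupling ^^ k) 0 = 0"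
  by (induction k) simp_all

lemma coupling_funpow_sum: "(coupling ^^ k) (sum f I) = (\<Sum>i\<in>I. (coupling ^^ k) (f i))"
  by (induction I rule: infinite_finite_induct) (simp_all add: coupling_funpow_add)

text \<open>The commutator of \<open>2 D_x D_y + D_y^2\<close> with multiplication by \<open>y\<close> is \<open>2 (D_x + D_y)\<close>. On the diagonal
\<open>y = x\<close> the operator \<open>D_x + D_y\<close> becomes differentiation.\<close>

lemma coupling_pCons_0:
  "coupling (pCons 0 F) = pCons 0 (coupling F) + smult [:2:] (dx F + pderiv F)"
proof -
  have two: "smult [:2:] G = G + G" for G :: "complex poly poly"
  proof -
    have "[:2:] = 1 + (1 :: complex poly)" by (simp add: one_pCons)
    then show ?thesis by (simp only: smult_add_left smult_1_left)
  qed
  show ?thesis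
    unfolding two by (simp add: coupling_def pderiv_pCons pderiv_add algebra_simps)
qed

lemma coupling_commute: "coupling (dx F + pderiv F) = dx (coupling F) + pderiv (coupling F)"
  unfolding coupling_def dx_simps pderiv_add dx_pderiv by (simp only: ac_simps)

lemma coupling_funpow_Suc_pCons_0:
  "(coupling ^^ Suc k) (pCons 0 F) = pCons 0 ((coupling ^^ Suc k) F)
     + smult [:2 * of_nat (Suc k):] (dx ((coupling ^^ k) F) + pderiv ((coupling ^^ k) F))"
proof (induction k)
  case 0
  then show ?case by (simp add: coupling_pCons_0 del: smult_pCons)
next
  case (Suc k)
  let ?G = "(coupling ^^ Suc k) F"
  have "(coupling ^^ Suc (Suc k)) (pCons 0 F)
      = coupling (pCons 0 ?G + smult [:2 * of_nat (Suc k):] (dx ((coupling ^^ k) F) + pderiv ((coupling ^^ k) F)))"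
    using Suc.IH by simp
  also have "\<dots> = pCons 0 (coupling ?G) + (smult [:2:] (dx ?G + pderiv ?G)
      + smult [:2 * of_nat (Suc k):] (dx ?G + pderiv ?G))"
    unfolding coupling_add coupling_smult coupling_pCons_0
    by (simp add: coupling_commute[symmetric] coupling_add add.assoc del: smult_pCons)
  also have "smult [:2:] (dx ?G + pderiv ?G) + smult [:2 * of_nat (Suc k):] (dx ?G + pderiv ?G)
      = smult [:2 * of_nat (Suc (Suc k)):] (dx ?G + pderiv ?G)"
    unfolding smult_add_left[symmetric] by (simp add: algebra_simps)
  finally show ?case by simp
qed

lemma coupling_funpow_monom_eq_0: "j < k \<Longrightarrow> (coupling ^^ k) (monom p j) = 0"
proof (induction j arbitrary: k)
  case 0
  then obtain i where "k = Suc i" by (cases k) auto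
  moreover have "coupling (monom p 0) = 0"
    by (simp add: coupling_def monom_0 pderiv_pCons)
  ultimately show ?case by (simp only: funpow_Suc_right o_apply coupling_funpow_0)
next
  case (Suc j)
  then obtain i where "k = Suc i" "j < i" by (cases k) auto
  then show ?case
    by (simp add: monom_Suc coupling_funpow_Suc_pCons_0 Suc.IH del: funpow.simps)
qed

text \<open>The exponential of \<open>- (2 D_x D_y + D_y^2) / 4\<close>, truncated after the power \<open>n\<close> and followed by the
substitution \<open>y = x\<close>. Truncation loses nothing for a polynomial of degree at most \<open>n\<close> in \<open>y\<close>.\<close>

definition normal_ordering :: "nat \<Rightarrow> complex poly poly \<Rightarrow> complex poly" where
  "normal_ordering n F = (\<Sum>k\<le>n. smult ((- 1 / 4) ^ k / fact k) (diag ((coupling ^^ k) F)))"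

lemma normal_ordering_pCons_0:
  "normal_ordering (Suc n) (pCons 0 F)
     = pCons 0 (normal_ordering (Suc n) F) - smult (1 / 2) (pderiv (normal_ordering n F))"
proof -
  let ?c = "\<lambda>k. (- 1 / 4 :: complex) ^ k / fact k"
  let ?d = "\<lambda>k. diag ((coupling ^^ k) F)"
  have c_Suc: "?c (Suc k) * (2 * of_nat (Suc k)) = - (1 / 2) * ?c k" for k
  proof -
    have "of_nat (Suc k) \<noteq> (0 :: complex)" by (simp only: of_nat_neq_0 not_False_eq_True)
    then show ?thesis by (simp add: fact_Suc field_simps del: of_nat_Suc)
  qed
  have "diag (dx G + pderiv G) = pderiv (diag G)" for G
    by (simp add: pderiv_poly_substitution pderiv_pCons)
  then have d_Suc: "diag ((coupling ^^ Suc k) (pCons 0 F))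
      = pCons 0 (?d (Suc k)) + smult (2 * of_nat (Suc k)) (pderiv (?d k))" for k
    unfolding coupling_funpow_Suc_pCons_0 poly_add diag_smult by simp
  have "normal_ordering (Suc n) (pCons 0 F)
      = pCons 0 (?d 0) + (\<Sum>k\<le>n. smult (?c (Suc k)) (diag ((coupling ^^ Suc k) (pCons 0 F))))"
    unfolding normal_ordering_def by (subst sum.atMost_Suc_shift) simp
  also have "(\<Sum>k\<le>n. smult (?c (Suc k)) (diag ((coupling ^^ Suc k) (pCons 0 F))))
      = (\<Sum>k\<le>n. pCons 0 (smult (?c (Suc k)) (?d (Suc k)))) - smult (1 / 2) (\<Sum>k\<le>n. smult (?c k) (pderiv (?d k)))"
  proof -
    have "smult (?c (Suc k)) (diag ((coupling ^^ Suc k) (pCons 0 F)))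
        = pCons 0 (smult (?c (Suc k)) (?d (Suc k))) - smult (1 / 2) (smult (?c k) (pderiv (?d k)))" for k
      unfolding d_Suc smult_add_right smult_smult c_Suc by simp
    then show ?thesis unfolding smult_sum_distrib by (simp add: sum_subtractf)
  qed
  also have "(\<Sum>k\<le>n. smult (?c k) (pderiv (?d k))) = pderiv (normal_ordering n F)"
  proof -
    have "pderiv (\<Sum>k\<le>n. smult (c k) (f k)) = (\<Sum>k\<le>n. smult (c k) (pderiv (f k)))"
      for c and f :: "nat \<Rightarrow> complex poly"
      by (induction n) (simp_all add: pderiv_add pderiv_smult)
    then show ?thesis by (simp only: normal_ordering_def)
  qed
  also have "pCons 0 (?d 0) + ((\<Sum>k\<le>n. pCons 0 (smult (?c (Suc k)) (?d (Suc k))))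
        - smult (1 / 2) (pderiv (normal_ordering n F)))
      = pCons 0 (normal_ordering (Suc n) F) - smult (1 / 2) (pderiv (normal_ordering n F))"
  proof -
    have pCons_0_add: "pCons 0 (p + q) = pCons 0 p + pCons 0 q" for p q :: "complex poly" by simp
    have "pCons 0 (\<Sum>k\<le>n. f k) = (\<Sum>k\<le>n. pCons 0 (f k))" for f :: "nat \<Rightarrow> complex poly"
      by (induction n) (simp_all add: pCons_0_add del: add_pCons)
    moreover have "normal_ordering (Suc n) F = ?d 0 + (\<Sum>k\<le>n. smult (?c (Suc k)) (?d (Suc k)))"
      unfolding normal_ordering_def by (subst sum.atMost_Suc_shift) simp
    ultimately show ?thesis by (simp only: add_diff_eq pCons_0_add)
  qed
  finally show ?thesis .
qed

text \<open>This turns \<open>y^j p(x)\<close> into \<open>(x - D/2)^j p(x)\<close>. By the commutator above, multiplication by \<open>y\<close> before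
the exponential amounts to applying \<open>x - D/2\<close> after it.\<close>

lemma normal_ordering_monom:
  "j \<le> n \<Longrightarrow> normal_ordering n (monom p j) = (hermite_raise ^^ j) p"
proof (induction j arbitrary: n)
  case 0
  have "normal_ordering n (monom p 0) = (\<Sum>k\<le>n. if k = 0 then p else 0)"
    unfolding normal_ordering_def
    by (intro sum.cong) (auto simp: coupling_funpow_monom_eq_0 poly_monom)
  then show ?case by simp
next
  case (Suc j)
  then obtain m where m: "n = Suc m" "j \<le> m" by (cases n) auto
  then show ?case
    using Suc.IH[of "Suc m"] Suc.IH[of m]
    by (simp add: monom_Suc normal_ordering_pCons_0 hermite_raise_def)
qed

definition coupling_step :: "complex \<Rightarrow> complex poly poly \<Rightarrow> complex poly poly" where
  "coupling_step c F = F - smult [:c:] (coupling F)"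

lemma coupling_step_funpow:
  "(coupling_step c ^^ N) F = (\<Sum>k\<le>N. smult [:of_nat (N choose k) * (- c) ^ k:] ((coupling ^^ k) F))"
proof (induction N)
  case 0
  then show ?case by (simp flip: one_pCons)
next
  case (Suc N)
  let ?a = "\<lambda>k. (coupling ^^ k) F"
  let ?t = "\<lambda>k. smult [:of_nat (N choose k) * (- c) ^ k:] (?a k)"
  let ?s = "\<lambda>k. smult [:of_nat (N choose k) * (- c) ^ Suc k:] (?a (Suc k))"
  have neg: "- smult [:c:] (smult [:b:] G) = smult [:b * - c:] G" for b and G :: "complex poly poly"
  proof -
    have "[:b * - c:] = - [:c * b:]" by simp
    then show ?thesis by (simp only: smult_minus_left) (simp add: mult.commute)
  qed
  have "(coupling_step c ^^ Suc N) F = (\<Sum>k\<le>N. ?t k) + - smult [:c:] (\<Sum>k\<le>N. coupling (?t k))"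
  proof -
    have "(coupling_step c ^^ Suc N) F = coupling_step c (\<Sum>k\<le>N. ?t k)" using Suc.IH by simp
    then show ?thesis unfolding coupling_step_def[of c "\<Sum>k\<le>N. ?t k"] coupling_sum by simp
  qed
  also have "- smult [:c:] (\<Sum>k\<le>N. coupling (?t k)) = (\<Sum>k\<le>N. - smult [:c:] (coupling (?t k)))"
    by (simp only: smult_sum_distrib sum_negf)
  also have "\<dots> = (\<Sum>k\<le>N. ?s k)"
    unfolding coupling_smult neg by (simp add: mult_ac)
  also have "(\<Sum>k\<le>N. ?t k) = (\<Sum>k\<le>Suc N. ?t k)" by simp
  also have "\<dots> = ?t 0 + (\<Sum>k\<le>N. ?t (Suc k))" by (rule sum.atMost_Suc_shift)
  also have "?t 0 + (\<Sum>k\<le>N. ?t (Suc k)) + (\<Sum>k\<le>N. ?s k) = ?t 0 + (\<Sum>k\<le>N. ?t (Suc k) + ?s k)"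
    by (simp only: sum.distrib add.assoc)
  also have "?t 0 = smult [:of_nat (Suc N choose 0) * (- c) ^ 0:] (?a 0)" by simp
  also have "(\<Sum>k\<le>N. ?t (Suc k) + ?s k)
      = (\<Sum>k\<le>N. smult [:of_nat (Suc N choose Suc k) * (- c) ^ Suc k:] (?a (Suc k)))"
    by (intro sum.cong refl)
       (simp only: smult_add_left[symmetric] add_pCons add_0_left binomial_Suc_Suc of_nat_add distrib_right add.commute)
  also have "smult [:of_nat (Suc N choose 0) * (- c) ^ 0:] (?a 0)
      + (\<Sum>k\<le>N. smult [:of_nat (Suc N choose Suc k) * (- c) ^ Suc k:] (?a (Suc k)))
      = (\<Sum>k\<le>Suc N. smult [:of_nat (Suc N choose k) * (- c) ^ k:] (?a k))"
    by (rule sum.atMost_Suc_shift[symmetric])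
  finally show ?case .
qed

lemma coupling_step_funpow_nilpotent:
  assumes "\<And>k. n < k \<Longrightarrow> (coupling ^^ k) F = 0"
  shows "(coupling_step c ^^ N) F = (\<Sum>k\<le>n. smult [:of_nat (N choose k) * (- c) ^ k:] ((coupling ^^ k) F))"
proof -
  let ?t = "\<lambda>k. smult [:of_nat (N choose k) * (- c) ^ k:] ((coupling ^^ k) F)"
  have "(\<Sum>k\<le>N. ?t k) = (\<Sum>k\<le>max n N. ?t k)"
    by (rule sum.mono_neutral_left) auto
  moreover have "(\<Sum>k\<le>n. ?t k) = (\<Sum>k\<le>max n N. ?t k)"
    by (rule sum.mono_neutral_left) (auto simp: assms)
  ultimately show ?thesis by (simp add: coupling_step_funpow)
qed

text \<open>Besides the absence of zeros with \<open>x\<close> and \<open>y\<close> in the upper half-plane, the leading coefficient in \<open>y\<close>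
must not vanish for such \<open>x\<close>. Then the degree in \<open>y\<close> is the same for all these \<open>x\<close>, and the derivative
in \<open>y\<close> cannot vanish identically for a single \<open>x\<close>.\<close>

definition bistable :: "complex poly poly \<Rightarrow> bool" where
  "bistable F \<longleftrightarrow> stable (lead_coeff F) \<and> (\<forall>y. Im y > 0 \<longrightarrow> stable (poly F [:y:]))"

lemma poly_slice: "poly (map_poly (\<lambda>a. poly a x) F) y = poly (poly F [:y:]) x"
  by (induction F) (simp_all add: map_poly_pCons)

lemma pderiv_slice: "pderiv (map_poly (\<lambda>a. poly a x) F) = map_poly (\<lambda>a. poly a x) (pderiv F)"
  by (rule poly_eqI) (simp add: coeff_pderiv coeff_map_poly del: of_nat_Suc)

text \<open>Put \<open>G = D_y F\<close>. If \<open>F\<close> has positive degree in \<open>y\<close>, then \<open>G\<close> has no zeros by Gauss-Lucas in \<open>y\<close>, and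
\<open>F - c (2 D_x D_y + D_y^2) F = G (F/G - 2 c (D_x G)/G - c (D_y G)/G)\<close>. In the second factor \<open>F/G\<close> has
positive imaginary part, while the logarithmic derivatives of \<open>G\<close> have nonpositive imaginary parts.\<close>

lemma bistable_coupling_step:
  assumes F: "bistable F" and c: "c \<ge> 0"
  shows "bistable (coupling_step (of_real c) F)"
proof (cases "degree F = 0")
  case True
  then obtain a where "F = [:a:]" by (metis degree_eq_zeroE)
  then have "coupling F = 0" by (simp add: coupling_def pderiv_pCons)
  then show ?thesis using F by (simp add: coupling_step_def)
next
  case False
  define G where "G = pderiv F"
  have coupling_eq: "coupling F = dx G + dx G + pderiv G"
    by (simp add: coupling_def G_def dx_pderiv)
  have "degree (pderiv (dx F)) < degree F" "degree (pderiv (pderiv F)) < degree F"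
    using False map_poly_degree_leq[of pderiv F] by (auto simp: degree_pderiv dx_def)
  then have "degree (coupling F) < degree F"
    unfolding coupling_def by (intro degree_add_less) auto
  then have deg: "degree (smult [:of_real c:] (coupling F)) < degree F"
    using degree_smult_le le_less_trans by blast
  have "degree (coupling_step (of_real c) F) = degree F"
    unfolding coupling_step_def diff_conv_add_uminus using deg by (intro degree_add_eq_left) simp
  then have "lead_coeff (coupling_step (of_real c) F) = lead_coeff F"
    using coeff_eq_0[OF deg] by (simp add: coupling_step_def)
  moreover have "stable (poly (coupling_step (of_real c) F) [:y:])" if y: "Im y > 0" for y
    unfolding stable_def
  proof (intro allI impI)
    fix x assume x: "Im x > 0"
    let ?s = "\<lambda>x. map_poly (\<lambda>a. poly a x)"
    have stF: "stable (?s x F)" if "Im x > 0" for x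
      using F that unfolding stable_def poly_slice bistable_def by blast
    have G_quot: "Im (poly (poly G [:y:]) x / poly (poly F [:y:]) x) < 0" if "Im x > 0" for x
    proof -
      have "poly (lead_coeff F) x \<noteq> 0" using F that by (auto simp: bistable_def stable_def)
      then have "degree (?s x F) > 0" using False by (simp add: map_poly_degree_eq)
      from logarithmic_derivative_stable(2)[OF stF[OF that] y this] show ?thesis
        by (simp only: pderiv_slice poly_slice G_def)
    qed
    then have G_nz: "poly (poly G [:y:]) x \<noteq> 0" if "Im x > 0" for x
      using that by fastforce
    have stGx: "stable (?s x G)"
      using stable_pderiv[OF stF[OF x]] G_nz[OF x] unfolding pderiv_slice G_def[symmetric]
      by (metis poly_0 poly_slice)
    have "stable (poly G [:y:])" using G_nz by (auto simp: stable_def)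
    from logarithmic_derivative_stable(1)[OF this x]
    have Gx: "Im (poly (poly (dx G) [:y:]) x / poly (poly G [:y:]) x) \<le> 0"
      by (simp add: pderiv_poly_substitution pderiv_pCons)
    from logarithmic_derivative_stable(1)[OF stGx y]
    have Gy: "Im (poly (poly (pderiv G) [:y:]) x / poly (poly G [:y:]) x) \<le> 0"
      by (simp only: pderiv_slice poly_slice)
    have "inverse (poly (poly F [:y:]) x / poly (poly G [:y:]) x) = poly (poly G [:y:]) x / poly (poly F [:y:]) x"
      by simp
    then have FG: "Im (poly (poly F [:y:]) x / poly (poly G [:y:]) x) > 0"
      using G_quot[OF x] by (metis Im_inverse_neg_iff)
    let ?g = "poly (poly G [:y:]) x"
    define u v w where "u = poly (poly F [:y:]) x / ?g"
      and "v = poly (poly (dx G) [:y:]) x / ?g" and "w = poly (poly (pderiv G) [:y:]) x / ?g"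
    have "poly (poly (coupling_step (of_real c) F) [:y:]) x
        = ?g * (u - of_real c * v - of_real c * v - of_real c * w)"
      unfolding coupling_step_def coupling_eq u_def v_def w_def
      using G_nz[OF x] by (simp add: field_simps)
    moreover have "Im (u - of_real c * v - of_real c * v - of_real c * w) > 0"
    proof -
      have "c * Im v \<le> 0" "c * Im w \<le> 0"
        using c Gx Gy by (simp_all add: mult_nonneg_nonpos v_def w_def del: Im_divide)
      moreover have "Im (u - of_real c * v - of_real c * v - of_real c * w) = Im u - 2 * (c * Im v) - c * Im w"
        by simp
      ultimately show ?thesis using FG unfolding u_def[symmetric] by linarith
    qed
    then have "u - of_real c * v - of_real c * v - of_real c * w \<noteq> 0"
      by (metis less_irrefl zero_complex.sel(2))
    ultimately show "poly (poly (coupling_step (of_real c) F) [:y:]) x \<noteq> 0"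
      using G_nz[OF x] by simp
  qed
  ultimately show ?thesis using F by (simp add: bistable_def)
qed

lemma stable_diag:
  assumes "bistable F" shows "stable (diag F)"
proof -
  have "poly (diag F) x = poly (poly F [:x:]) x" for x
    by (induction F) simp_all
  then show ?thesis using assms by (simp add: bistable_def stable_def)
qed

text \<open>After division by \<open>y p\<close> this is \<open>a / y + p' / p\<close>, a sum of two terms whose imaginary parts are negative
and nonpositive.\<close>

lemma stable_first_order:
  assumes "stable p" and a: "a > 0" and y: "Im y > 0"
  shows "stable (smult (of_real a) p + smult y (pderiv p))"
  unfolding stable_def
proof (intro allI impI)
  fix z assume z: "Im z > 0"
  then have p: "poly p z \<noteq> 0" and "y \<noteq> 0" using assms by (auto simp: stable_def)
  define w where "w = of_real a * inverse y + poly (pderiv p) z / poly p z"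
  have "poly (smult (of_real a) p + smult y (pderiv p)) z = poly p z * y * w"
    using p \<open>y \<noteq> 0\<close> by (simp add: w_def field_simps)
  moreover have "Im (of_real a * inverse y + poly (pderiv p) z / poly p z) < 0"
  proof -
    have "a * Im (inverse y) < 0" using a y Im_inverse_neg_iff[of y] by (metis mult_pos_neg)
    moreover have "Im (of_real a * inverse y) = a * Im (inverse y)" by simp
    ultimately show ?thesis
      using logarithmic_derivative_stable(1)[OF assms(1) z] by (metis add_neg_nonpos plus_complex.sel(2))
  qed
  then have "w \<noteq> 0" unfolding w_def[symmetric] by auto
  ultimately show "poly (smult (of_real a) p + smult y (pderiv p)) z \<noteq> 0"
    using p \<open>y \<noteq> 0\<close> by simp
qed

text \<open>The sum is \<open>q(y D) p\<close>, and \<open>q(y D)\<close> is a nonzero constant times a product of operators \<open>a + y D\<close> with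
\<open>a > 0\<close>.\<close>

lemma stable_negative_zeros_combination:
  assumes p: "stable p" and n: "degree p \<le> n" and y: "Im y > 0"
    and "q \<noteq> 0" and "\<And>z. poly q z = 0 \<Longrightarrow> z \<in> \<real> \<and> Re z < 0"
  shows "stable (\<Sum>j\<le>n. smult (coeff q j * y ^ j) ((pderiv ^^ j) p))"
  using assms(4,5)
proof (induction q rule: complex_poly_linear_factor_induct)
  case (const c)
  have "(\<Sum>j\<le>n. smult (coeff [:c:] j * y ^ j) ((pderiv ^^ j) p)) = (\<Sum>j\<le>n. if j = 0 then smult c p else 0)"
    by (intro sum.cong) (auto simp: coeff_pCons split: nat.splits)
  then show ?case using p const by (simp add: stable_def)
next
  case (linear_factor r q)
  let ?D = "\<lambda>j. (pderiv ^^ j) p"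
  define W where "W = (\<Sum>j\<le>n. smult (coeff q j * y ^ j) (?D j))"
  have "r \<in> \<real> \<and> Re r < 0" by (rule linear_factor.prems(2)) simp
  then obtain a where a: "r = - of_real a" "a > 0"
    by (elim conjE Reals_cases) (metis Re_complex_of_real minus_minus neg_0_less_iff_less of_real_minus)
  have "stable W"
    unfolding W_def
  proof (rule linear_factor.IH)
    show "q \<noteq> 0" using linear_factor.prems(1) by auto
    show "z \<in> \<real> \<and> Re z < 0" if "poly q z = 0" for z
      using that by (intro linear_factor.prems(2)) simp
  qed
  moreover have "(\<Sum>j\<le>n. smult (coeff ([:-r, 1:] * q) j * y ^ j) (?D j)) = smult (of_real a) W + smult y (pderiv W)"
  proof -
    let ?u = "\<lambda>j. smult (coeff (pCons 0 q) j * y ^ j) (?D j)"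
    have "degree (?D (Suc n)) = 0" "degree (?D n) = 0" using n by (simp_all only: degree_higher_pderiv)
    then have top: "?D (Suc n) = 0" by (simp add: pderiv_eq_0_iff)
    have "(\<Sum>j\<le>n. ?u j) = (\<Sum>j\<le>Suc n. ?u j)" using top by simp
    also have "\<dots> = ?u 0 + (\<Sum>j\<le>n. ?u (Suc j))" by (rule sum.atMost_Suc_shift)
    also have "\<dots> = (\<Sum>j\<le>n. smult y (pderiv (smult (coeff q j * y ^ j) (?D j))))"
      by (simp add: pderiv_smult mult_ac)
    also have "\<dots> = smult y (pderiv W)"
      unfolding W_def by (induction n) (simp_all add: pderiv_add smult_add_right)
    finally have shift: "(\<Sum>j\<le>n. ?u j) = smult y (pderiv W)" .
    have "smult (coeff ([:-r, 1:] * q) j * y ^ j) (?D j)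
        = smult (of_real a) (smult (coeff q j * y ^ j) (?D j)) + ?u j" for j
      by (simp add: a smult_add_left[symmetric] algebra_simps)
    moreover have "(\<Sum>j\<le>n. smult (of_real a) (smult (coeff q j * y ^ j) (?D j))) = smult (of_real a) W"
      unfolding W_def by (induction n) (simp_all add: smult_add_right)
    ultimately show ?thesis by (simp add: sum.distrib shift)
  qed
  ultimately show ?case using stable_first_order[OF _ a(2) y] by simp
qed

lemma bistable_negative_zeros_combination:
  assumes p: "stable p" and q0: "coeff q 0 \<noteq> 0" and roots: "\<And>z. poly q z = 0 \<Longrightarrow> z \<in> \<real> \<and> Re z < 0"
  shows "bistable (\<Sum>j\<le>degree p. monom (smult (coeff q j) ((pderiv ^^ j) p)) j)"
    (is "bistable ?F")
proof -
  have p0: "p \<noteq> 0" using p unfolding stable_def by (metis imaginary_unit.sel(2) poly_0 zero_less_one)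
  have coeff: "coeff ?F j = (if j \<le> degree p then smult (coeff q j) ((pderiv ^^ j) p) else 0)" for j
    by (simp add: coeff_sum)
  have "coeff ?F 0 \<noteq> 0" unfolding coeff using q0 p0 by simp
  then have "?F \<noteq> 0" by (metis coeff_0)
  define d where "d = degree ?F"
  have "coeff ?F d \<noteq> 0" unfolding d_def using \<open>?F \<noteq> 0\<close> by (simp only: leading_coeff_neq_0 not_False_eq_True)
  then have "coeff q d \<noteq> 0" and "(pderiv ^^ d) p \<noteq> 0"
    and "coeff ?F d = smult (coeff q d) ((pderiv ^^ d) p)"
    unfolding coeff by (auto split: if_splits)
  then have "stable (coeff ?F d)"
    using stable_higher_pderiv[OF p, of d] by (simp add: stable_def)
  moreover have "stable (poly ?F [:y:])" if "Im y > 0" for y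
  proof -
    have pow: "[:y:] ^ j = [:y ^ j:]" for j by (induction j) (simp_all add: one_pCons)
    have "poly ?F [:y:] = (\<Sum>j\<le>degree p. smult (coeff q j * y ^ j) ((pderiv ^^ j) p))"
      unfolding poly_sum poly_monom pow by (simp add: mult.commute)
    moreover have "q \<noteq> 0" using q0 by auto
    ultimately show ?thesis
      using stable_negative_zeros_combination[OF p order_refl that _ roots] by simp
  qed
  ultimately show ?thesis by (simp add: bistable_def d_def)
qed

section \<open>Limits and the Hermite multiplier theorem\<close>

text \<open>Hurwitz's theorem on the upper half-plane.\<close>

lemma stable_locally_uniform_limit:
  assumes st: "\<And>N :: nat. stable (f N)"
    and lim: "\<And>K. compact K \<Longrightarrow> uniform_limit K (\<lambda>N. poly (f N)) (poly g) sequentially"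
  shows "g = 0 \<or> stable g"
proof (cases "degree g = 0")
  case True
  then obtain c where "g = [:c:]" by (metis degree_eq_zeroE)
  then show ?thesis by (auto simp: stable_def)
next
  case False
  let ?U = "{z. Im z > 0}"
  have "open ?U" by (rule open_halfspace_Im_gt)
  moreover have "connected ?U" by (intro convex_connected convex_halfspace_Im_gt)
  moreover have "\<not> poly g constant_on ?U"
  proof
    assume "poly g constant_on ?U"
    then obtain c where c: "\<And>z. Im z > 0 \<Longrightarrow> poly g z = c" by (auto simp: constant_on_def)
    have "?U \<subseteq> {z. poly (g - [:c:]) z = 0}" using c by auto
    moreover have "infinite ?U"
    proof
      assume "finite ?U"
      then have "?U = {}" using \<open>open ?U\<close> finite_imp_not_open by blast
      moreover have "\<i> \<in> ?U" by simp
      ultimately show False by blast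
    qed
    ultimately have "infinite {z. poly (g - [:c:]) z = 0}" by (rule infinite_super)
    then have "g - [:c:] = 0" using poly_roots_finite[of "g - [:c:]"] by blast
    then show False using False by simp
  qed
  moreover have "poly (f N) holomorphic_on ?U" "poly g holomorphic_on ?U" for N
    by (intro holomorphic_intros)+
  moreover have "poly (f N) z \<noteq> 0" if "z \<in> ?U" for N z
    using st that by (simp add: stable_def)
  ultimately have "poly g z \<noteq> 0" if "z \<in> ?U" for z
    using Hurwitz_no_zeros[of ?U "\<lambda>N. poly (f N)" "poly g", OF _ _ _ _ lim _ _ that] by blast
  then show ?thesis by (simp add: stable_def)
qed

lemma stable_limit_linear_combination:
  fixes a :: "'i \<Rightarrow> nat \<Rightarrow> complex"
  assumes st: "\<And>N. stable (\<Sum>i\<in>I. smult (a i N) (R i))"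
    and lim: "\<And>i. i \<in> I \<Longrightarrow> a i \<longlonglongrightarrow> b i"
  shows "(\<Sum>i\<in>I. smult (b i) (R i)) = 0 \<or> stable (\<Sum>i\<in>I. smult (b i) (R i))"
proof (rule stable_locally_uniform_limit[OF st])
  fix K :: "complex set" assume K: "compact K"
  have summand: "uniform_limit K (\<lambda>N z. a i N * poly (R i) z) (\<lambda>z. b i * poly (R i) z) sequentially"
    if "i \<in> I" for i
  proof (rule uniform_lim_mult)
    show "uniform_limit K (\<lambda>N z. a i N) (\<lambda>z. b i) sequentially"
      using lim[OF that] by (auto simp: uniform_limit_iff tendsto_iff elim!: eventually_mono)
    show "bounded ((\<lambda>z. poly (R i) z) ` K)"
      using K by (intro compact_imp_bounded compact_continuous_image continuous_intros)
    show "bounded ((\<lambda>z. b i) ` K)" by (rule bounded_subset[of "{b i}"]) auto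
  qed (rule uniform_limit_const)
  have "uniform_limit K (\<lambda>N z. \<Sum>i\<in>J. a i N * poly (R i) z) (\<lambda>z. \<Sum>i\<in>J. b i * poly (R i) z) sequentially"
    if "J \<subseteq> I" for J
    using that
  proof (induction J rule: infinite_finite_induct)
    case (insert i J)
    then show ?case by (simp add: uniform_limit_add summand)
  qed (simp_all add: uniform_limit_const)
  then show "uniform_limit K (\<lambda>N. poly (\<Sum>i\<in>I. smult (a i N) (R i))) (poly (\<Sum>i\<in>I. smult (b i) (R i))) sequentially"
    by (simp add: poly_sum[abs_def])
qed

lemma only_real_zeros_if_laguerre_polya:
  assumes "cpoly q \<in> laguerre_polya"
  shows "only_real_zeros q"
proof (cases "q = 0")
  case False
  obtain p where rz: "\<And>n. only_real_zeros (p n)"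
    and lim: "\<And>K. compact K \<Longrightarrow> uniform_limit K (\<lambda>n. cpoly (p n)) (cpoly q) sequentially"
    using assms by (auto simp: laguerre_polya_def)
  have "cplx q \<noteq> 0" using False by (simp add: map_poly_eq_0_iff)
  then obtain z where z: "cpoly q z \<noteq> 0" unfolding cpoly_def by (metis poly_all_0_iff_0)
  have "(\<lambda>n. cpoly (p n) z) \<longlonglongrightarrow> cpoly q z"
    using lim[of "{z}"] by simp
  then have "\<forall>\<^sub>F n in sequentially. cpoly (p n) z \<noteq> 0"
    using z by (rule tendsto_imp_eventually_ne)
  then obtain M where M: "\<And>n. n \<ge> M \<Longrightarrow> cpoly (p n) z \<noteq> 0"
    by (auto simp: eventually_sequentially)
  have "stable (cplx (p (n + M)))" for n
    using rz[of "n + M"] M[of "n + M"] by (auto simp: only_real_zeros_iff_stable cpoly_def)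
  moreover have "uniform_limit K (\<lambda>n. poly (cplx (p (n + M)))) (poly (cplx q)) sequentially"
    if "compact K" for K
    using filterlim_compose[OF lim[OF that] filterlim_add_const_nat_at_top[of M]]
    by (simp add: cpoly_def[abs_def])
  ultimately have "cplx q = 0 \<or> stable (cplx q)" by (rule stable_locally_uniform_limit)
  then show ?thesis using \<open>cplx q \<noteq> 0\<close> by (simp add: only_real_zeros_iff_stable)
qed (simp add: only_real_zeros_def)

lemma laguerre_polya_if_only_real_zeros:
  assumes "only_real_zeros q"
  shows "cpoly q \<in> laguerre_polya"
proof -
  have "cpoly q holomorphic_on UNIV"
    unfolding cpoly_def[abs_def] by (intro holomorphic_intros)
  then show ?thesis
    using assms by (auto simp: laguerre_polya_def uniform_limit_const intro!: exI[of _ "\<lambda>_. q"])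
qed

lemma binomial_over_power_tendsto:
  "(\<lambda>N. real (Suc N choose j) / real (Suc N) ^ j) \<longlonglongrightarrow> 1 / fact j"
proof (induction j)
  case (Suc j)
  have "real (Suc N choose Suc j) / real (Suc N) ^ Suc j
      = real (Suc N choose j) / real (Suc N) ^ j * (real (Suc N - j) / real (Suc N) / real (Suc j))" for N
  proof -
    have "(Suc N - j) * (Suc N choose j) = Suc j * (Suc N choose Suc j)"
      using binomial_absorb_comp[of "Suc N" j] Suc_times_binomial[of j N] by simp
    then have "real (Suc N - j) * real (Suc N choose j) = real (Suc j) * real (Suc N choose Suc j)"
      by (metis of_nat_mult)
    then show ?thesis by (simp add: divide_simps del: of_nat_Suc binomial_Suc_Suc) (simp add: mult_ac)
  qed
  moreover have "(\<lambda>N. real (Suc N - j) / real (Suc N)) \<longlonglongrightarrow> 1"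
  proof (rule Lim_transform_eventually)
    have "(\<lambda>N. 1 - real j * inverse (real (Suc N))) \<longlonglongrightarrow> 1 - real j * 0"
      by (intro tendsto_intros LIMSEQ_inverse_real_of_nat)
    then show "(\<lambda>N. 1 - real j * inverse (real (Suc N))) \<longlonglongrightarrow> 1" by simp
    show "\<forall>\<^sub>F N in sequentially. 1 - real j * inverse (real (Suc N)) = real (Suc N - j) / real (Suc N)"
      using eventually_ge_at_top[of j]
      by eventually_elim (simp add: of_nat_diff field_simps del: of_nat_Suc)
  qed
  then have "(\<lambda>N. real (Suc N choose j) / real (Suc N) ^ j * (real (Suc N - j) / real (Suc N) / real (Suc j)))
      \<longlonglongrightarrow> 1 / fact j * (1 / real (Suc j))"
    by (intro tendsto_mult Suc.IH tendsto_divide tendsto_const) auto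
  ultimately show ?case by (simp only: fact_Suc of_nat_mult) (simp add: mult.commute)
qed simp

lemma cplx_hermite_raise: "cplx ((hermite_raise ^^ j) p) = (hermite_raise ^^ j) (cplx p)"
proof (induction j)
  case (Suc j)
  have "cplx (hermite_raise r) = hermite_raise (cplx r)" for r
    unfolding hermite_raise_def pderiv_cplx
    by (rule poly_eqI) (simp add: coeff_map_poly coeff_pCons split: nat.splits)
  then show ?case using Suc by simp
qed simp

lemma scaled_jensen_negative_zeros:
  assumes rr: "real_rooted_jensen \<beta>" and nonneg: "\<And>j. \<beta> j \<ge> 0" and pos: "\<beta> 0 > 0"
    and t: "t > 0" and root: "poly (pcompose (cplx (jensen N \<beta>)) [:0, complex_of_real t:]) z = 0"
  shows "z \<in> \<real> \<and> Re z < 0"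
proof -
  have "cpoly (jensen N \<beta>) (of_real t * z) = 0"
    using root by (simp add: poly_pcompose cpoly_def mult.commute)
  moreover have "coeff (jensen N \<beta>) 0 \<noteq> 0" using pos by (simp add: coeff_jensen)
  then have "jensen N \<beta> \<noteq> 0" by auto
  ultimately have "of_real t * z \<in> \<real>"
    using rr by (auto simp: real_rooted_jensen_def only_real_zeros_def)
  then have "z \<in> \<real>"
    using t by (metis Reals_divide Reals_of_real less_irrefl nonzero_mult_div_cancel_left of_real_eq_0_iff)
  then obtain x where x: "z = of_real x" by (auto elim: Reals_cases)
  have "poly (jensen N \<beta>) (t * x) > 0" if "x \<ge> 0"
  proof -
    have "poly (jensen N \<beta>) (t * x) = (\<Sum>k\<le>N. real (N choose k) * \<beta> k * (t * x) ^ k)"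
      by (simp add: jensen_def poly_sum poly_monom)
    also have "\<dots> \<ge> (\<Sum>k\<in>{0}. real (N choose k) * \<beta> k * (t * x) ^ k)"
      using that t nonneg by (intro sum_mono2) auto
    finally show ?thesis using pos by simp
  qed
  moreover have "complex_of_real (poly r y) = cpoly r (of_real y)" for r y
    by (induction r) (simp_all add: cpoly_def map_poly_pCons)
  then have "complex_of_real (poly (jensen N \<beta>) (t * x)) = cpoly (jensen N \<beta>) (of_real t * z)"
    by (simp add: x)
  ultimately show ?thesis
    using \<open>cpoly (jensen N \<beta>) (of_real t * z) = 0\<close> \<open>z \<in> \<real>\<close> x
    by (metis Re_complex_of_real less_irrefl not_le of_real_eq_0_iff)
qed

text \<open>\<open>Q\<close> is a limit of the polynomials \<open>H N\<close>, obtained in three moves: the coefficients \<open>\<beta> j / j!\<close> are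
replaced by those of \<open>jensen (N + 1) \<beta>\<close> in the variable \<open>y / (N + 1)\<close>, the
exponential in \<open>normal_ordering\<close> is replaced by a power of \<open>coupling_step\<close> with exponent \<open>N + 1\<close>, and
\<open>y = x\<close> is set. Both replacements converge because \<open>(N choose j) / N^j\<close> tends to \<open>1 / j!\<close>.\<close>

lemma hermite_operator_preserves_stability:
  assumes rr: "real_rooted_jensen \<beta>" and nonneg: "\<And>j. \<beta> j \<ge> 0" and pos: "\<beta> 0 > 0"
    and p: "stable p"
  defines "n \<equiv> degree p"
  defines "Q \<equiv> (\<Sum>j\<le>n. smult (of_real (\<beta> j / fact j)) ((hermite_raise ^^ j) ((pderiv ^^ j) p)))"
  shows "Q = 0 \<or> stable Q"
proof -
  define t where "t N = 1 / real (Suc N)" for N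
  define q where "q N = pcompose (cplx (jensen (Suc N) \<beta>)) [:0, complex_of_real (t N):]" for N
  define m where "m j = monom ((pderiv ^^ j) p) j" for j
  define F where "F N = (\<Sum>j\<le>n. smult [:coeff (q N) j:] (m j))" for N
  define a where "a N k = of_nat (Suc N choose k) * (- complex_of_real (t N / 4)) ^ k" for N k
  define H where "H N = diag ((coupling_step (of_real (t N / 4)) ^^ Suc N) (F N))" for N
  have t_pos: "t N > 0" for N by (simp add: t_def)
  have F_bistable: "bistable (F N)" for N
  proof -
    have F_eq: "F N = (\<Sum>j\<le>degree p. monom (smult (coeff (q N) j) ((pderiv ^^ j) p)) j)"
      unfolding F_def n_def m_def by (simp add: smult_monom)
    have q0: "coeff (q N) 0 \<noteq> 0"
      using pos by (simp add: q_def poly_0_coeff_0 coeff_map_poly coeff_jensen)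
    have roots: "z \<in> \<real> \<and> Re z < 0" if "poly (q N) z = 0" for z
      using that unfolding q_def by (rule scaled_jensen_negative_zeros[OF rr nonneg pos t_pos])
    show ?thesis
      unfolding F_eq using p q0 roots by (rule bistable_negative_zeros_combination)
  qed
  have "bistable ((coupling_step (of_real (t N / 4)) ^^ i) (F N))" for N i
    by (induction i) (use F_bistable bistable_coupling_step[of _ "t N / 4"] t_pos[of N] in \<open>simp_all add: less_imp_le\<close>)
  then have H_stable: "stable (H N)" for N
    unfolding H_def by (intro stable_diag)
  have nilpotent: "(coupling ^^ k) (F N) = 0" if "n < k" for N k
    unfolding F_def coupling_funpow_sum coupling_funpow_smult m_def
    using that by (intro sum.neutral) (simp add: coupling_funpow_monom_eq_0)
  have H_eq: "H N = (\<Sum>(k, j)\<in>{..n} \<times> {..n}. smult (a N k * coeff (q N) j) (diag ((coupling ^^ k) (m j))))" for N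
  proof -
    have step: "(coupling_step c ^^ M) (F N)
        = (\<Sum>k\<le>n. smult [:of_nat (M choose k) * (- c) ^ k:] ((coupling ^^ k) (F N)))" for c M
      using nilpotent by (rule coupling_step_funpow_nilpotent)
    have "H N = (\<Sum>k\<le>n. smult (a N k) (diag ((coupling ^^ k) (F N))))"
      by (simp only: H_def step poly_sum diag_smult a_def)
    also have "\<dots> = (\<Sum>k\<le>n. \<Sum>j\<le>n. smult (a N k * coeff (q N) j) (diag ((coupling ^^ k) (m j))))"
    proof (intro sum.cong refl)
      fix k
      show "smult (a N k) (diag ((coupling ^^ k) (F N)))
          = (\<Sum>j\<le>n. smult (a N k * coeff (q N) j) (diag ((coupling ^^ k) (m j))))"
        unfolding F_def coupling_funpow_sum coupling_funpow_smult poly_sum diag_smult smult_sum_distrib by simp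
    qed
    finally show ?thesis by (simp add: sum.cartesian_product)
  qed
  have a_lim: "(\<lambda>N. a N k) \<longlonglongrightarrow> (- 1 / 4) ^ k / fact k" for k
  proof -
    have "a N k = of_real ((- 1 / 4) ^ k * (real (Suc N choose k) / real (Suc N) ^ k))" for N
    proof -
      have base: "- complex_of_real (t N / 4) = of_real ((- 1 / 4) * (1 / real (Suc N)))"
        by (simp add: t_def)
      have power: "((- 1 / 4) * (1 / real (Suc N))) ^ k = (- 1 / 4) ^ k * (1 / real (Suc N) ^ k)"
        by (simp only: power_mult_distrib power_one_over)
      show ?thesis
        unfolding a_def base of_real_power[symmetric] power
        by (simp del: of_nat_Suc binomial_Suc_Suc)
    qed
    moreover have "(\<lambda>N. complex_of_real ((- 1 / 4) ^ k * (real (Suc N choose k) / real (Suc N) ^ k)))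
        \<longlonglongrightarrow> of_real ((- 1 / 4) ^ k * (1 / fact k))"
      by (intro tendsto_intros binomial_over_power_tendsto)
    ultimately show ?thesis by simp
  qed
  have q_lim: "(\<lambda>N. coeff (q N) j) \<longlonglongrightarrow> of_real (\<beta> j / fact j)" for j
  proof -
    have "coeff (q N) j = of_real (\<beta> j * (real (Suc N choose j) / real (Suc N) ^ j))" for N
      by (simp add: q_def coeff_pcompose_linear coeff_map_poly coeff_jensen t_def power_divide)
    moreover have "(\<lambda>N. complex_of_real (\<beta> j * (real (Suc N choose j) / real (Suc N) ^ j)))
        \<longlonglongrightarrow> of_real (\<beta> j * (1 / fact j))"
      by (intro tendsto_intros binomial_over_power_tendsto)
    ultimately show ?thesis by simp
  qed
  define b where "b = (\<lambda>(k, j). (- 1 / 4) ^ k / fact k * complex_of_real (\<beta> j / fact j))"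
  have "(\<Sum>i\<in>{..n} \<times> {..n}. smult (b i) (diag ((coupling ^^ fst i) (m (snd i))))) = 0
      \<or> stable (\<Sum>i\<in>{..n} \<times> {..n}. smult (b i) (diag ((coupling ^^ fst i) (m (snd i)))))"
  proof (rule stable_limit_linear_combination)
    show "stable (\<Sum>i\<in>{..n} \<times> {..n}. smult (a N (fst i) * coeff (q N) (snd i)) (diag ((coupling ^^ fst i) (m (snd i)))))" for N
      using H_stable[of N] unfolding H_eq by (simp add: case_prod_unfold)
    show "(\<lambda>N. a N (fst i) * coeff (q N) (snd i)) \<longlonglongrightarrow> b i" for i
      unfolding b_def case_prod_unfold by (intro tendsto_mult a_lim q_lim)
  qed
  also have "(\<Sum>i\<in>{..n} \<times> {..n}. smult (b i) (diag ((coupling ^^ fst i) (m (snd i))))) = Q"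
  proof -
    have "(\<Sum>i\<in>{..n} \<times> {..n}. smult (b i) (diag ((coupling ^^ fst i) (m (snd i)))))
        = (\<Sum>k\<le>n. \<Sum>j\<le>n. smult (b (k, j)) (diag ((coupling ^^ k) (m j))))"
      by (simp add: sum.cartesian_product case_prod_unfold)
    also have "\<dots> = (\<Sum>j\<le>n. \<Sum>k\<le>n. smult (b (k, j)) (diag ((coupling ^^ k) (m j))))"
      by (rule sum.swap)
    also have "\<dots> = (\<Sum>j\<le>n. smult (of_real (\<beta> j / fact j)) (normal_ordering n (m j)))"
    proof (intro sum.cong refl)
      fix j
      show "(\<Sum>k\<le>n. smult (b (k, j)) (diag ((coupling ^^ k) (m j))))
          = smult (of_real (\<beta> j / fact j)) (normal_ordering n (m j))"
        unfolding normal_ordering_def b_def smult_sum_distrib by (simp add: mult.commute)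
    qed
    also have "\<dots> = Q"
      unfolding Q_def m_def by (intro sum.cong) (auto simp: normal_ordering_monom)
    finally show ?thesis .
  qed
  finally show ?thesis .
qed

text \<open>Piotrowski's theorem: a nondecreasing positive multiplier sequence is also one for the Hermite basis.\<close>

theorem hyperbolicity_preserving_if_nondecreasing:
  assumes rr: "real_rooted_jensen \<gamma>" and pos: "\<And>n. \<gamma> n > 0" and mono: "\<And>n. \<gamma> n \<le> \<gamma> (Suc n)"
    and diag: "diagonal_operator hermite \<gamma> T"
  shows "hyperbolicity_preserving T"
  unfolding hyperbolicity_preserving_def
proof (intro conjI allI impI)
  show lin: "poly_linear T" using diag by (simp add: diagonal_operator_def)
  fix p assume p: "only_real_zeros p"
  show "only_real_zeros (T p)"
  proof (cases "p = 0")
    case True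
    then show ?thesis using poly_linear_smult[OF lin, of 0 0] by (simp add: only_real_zeros_def)
  next
    case False
    let ?\<beta> = "iterated_fdiff_at_0 \<gamma>"
    have st: "stable (cplx p)" using p False by (simp add: only_real_zeros_iff_stable)
    have deg: "degree (cplx p) = degree p" by (simp add: degree_map_poly)
    have "cplx (T p) = (\<Sum>j\<le>degree (cplx p). smult (of_real (?\<beta> j / fact j))
        ((hermite_raise ^^ j) ((pderiv ^^ j) (cplx p))))"
      unfolding hermite_diagonal_operator_formula[OF diag order_refl] cplx_sum cplx_smult
        cplx_hermite_raise cplx_higher_pderiv deg ..
    moreover have "?\<beta> 0 > 0" using pos by (simp add: iterated_fdiff_at_0_def)
    ultimately have "cplx (T p) = 0 \<or> stable (cplx (T p))"
      using hermite_operator_preserves_stability[OF real_rooted_jensen_iterated_fdiff[OF rr]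
          iterated_fdiff_at_0_nonneg[OF pos mono rr] _ st] by metis
    then show ?thesis by (auto simp: only_real_zeros_iff_stable map_poly_eq_0_iff)
  qed
qed

theorem theorem41:
  fixes \<gamma> :: "nat \<Rightarrow> real" and T :: "real poly \<Rightarrow> real poly"
  assumes "classical_multiplier_sequence \<gamma>"
    and "\<And>n. \<gamma> n > 0"
    and "diagonal_operator hermite \<gamma> T"
  shows "hyperbolicity_preserving T \<longleftrightarrow> (\<forall>n. cpoly (T (monom 1 n)) \<in> laguerre_polya)"
proof
  assume T: "hyperbolicity_preserving T"
  have "only_real_zeros (monom 1 n)" for n
    by (auto simp: only_real_zeros_def cpoly_def map_poly_monom poly_monom)
  then show "\<forall>n. cpoly (T (monom 1 n)) \<in> laguerre_polya"
    using T by (auto simp: hyperbolicity_preserving_def intro: laguerre_polya_if_only_real_zeros)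
next
  assume LP: "\<forall>n. cpoly (T (monom 1 n)) \<in> laguerre_polya"
  have rr: "real_rooted_jensen \<gamma>"
    using assms(1) by (rule real_rooted_jensen_multiplier_sequence)
  have "\<gamma> k \<le> \<gamma> (k + 2)" for k
    using two_step_mono_if_only_real_zeros[OF assms(3) assms(2)] only_real_zeros_if_laguerre_polya LP by blast
  then have "\<gamma> k \<le> \<gamma> (Suc k)" for k
    using assms(2) rr by (intro real_rooted_jensen_mono_if_two_step_mono)
  then show "hyperbolicity_preserving T"
    using rr assms(2,3) by (intro hyperbolicity_preserving_if_nondecreasing)
qed

end
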